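(* Let $k\ge 1$, and let $G=(V,E)$ be a finite simple graph with $|V|\ge k$. Then the following hold. (1) If $G$ is a forest, then $\sum_{i=1}^k \lambda_i(L(G))\le |E|+2k-1$. (2) If $G$ has maximum degree at most $\Delta$, then $\sum_{i=1}^k \lambda_i(L(G))\le |E|+ k\cdot \min\{\Delta,k\}$. (3) If $G$ is planar, then $\sum_{i=1}^k \lambda_i(L(G))\le |E|+ 6k-6$. In particular, the bound $\sum_{i=1}^k \lambda_i(L(G))\le |E|+\binom{k+1}{2}$ holds for planar graphs for all $k\ge 10$. (4) If $G$ is square-free (that is, it has no cycles of length $4$), then $\sum_{i=1}^k \lambda_i(L(G))\le |E|+\left\lfloor k(1+\sqrt{8k-3})/2\right\rfloor$. In particular, the bound $\sum_{i=1}^k \lambda_i(L(G))\le |E|+\binom{k+1}{2}$ holds for square-free graphs for all $k\ge 7$. (5) If $G$ has girth at least $5$ (that is, it has no cycles of length smaller than $5$), then $\sum_{i=1}^k \lambda_i(L(G))\le |E|+\left\lfloor k \sqrt{2k-1}\right\rfloor$. In particular, the bound $\sum_{i=1}^k \lambda_i(L(G))\le |E|+\binom{k+1}{2}$ holds for graphs with girth at least $5$ for all $k\ge 1$. (6) Let $t\ge 1$. If $G$ has no path of length $t$, then $\sum_{i=1}^k \lambda_i(L(G))\le |E|+k(t-1)$. Similarly, for $t\ge 2$, if $G$ has no cycles of length greater than $t$, then $\sum_{i=1}^k \lambda_i(L(G))\le |E|+\left\lfloor t(2k-1)/2\right\rfloor$.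
   Context: $L(G)\in\mathbb{R}^{|V|\times|V|}$ is the Laplacian matrix of $G$: $L(G)_{u,u}=\deg_G(u)$, $L(G)_{u,v}=-1$ if $\{u,v\}\in E$, and $0$ otherwise. For a symmetric real matrix $M$, $\lambda_i(M)$ is its $i$-th largest eigenvalue (counted with multiplicity). The length of a path or cycle is its number of edges; "has no path/cycle" refers to (not necessarily induced) subgraphs. The bound $\sum_{i=1}^k \lambda_i(L(G))\le |E|+\binom{k+1}{2}$ is the one conjectured by Brouwer for all graphs with at least $k$ vertices.
   Formalization: In (3), the bound |E|+6k-6 for planar graphs is stated only for k ≥ 2, because it fails for k = 1 (for K_2, λ_1 = 2 while |E|+6-6 = 1); the consequence for k ≥ 10 is unchanged. *)

theory Defs
  imports "HOL-Analysis.Analysis" "HOL-Computational_Algebra.Polynomial"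
begin

section \<open>Finite simple graphs\<close>

text \<open>
  The vertex set of a graph is a finite type; a graph is given by its set of edges, each edge
  being the set of its two endpoints. As the type is arbitrary, statements about
  such graphs cover all finite simple graphs with at least one vertex (isolated vertices included).
\<close>

definition simple_graph :: "'v::finite set set \<Rightarrow> bool" where
  "simple_graph E \<longleftrightarrow> (\<forall>e\<in>E. card e = 2)"

definition vertex_degree :: "'v::finite set set \<Rightarrow> 'v \<Rightarrow> nat" where
  "vertex_degree E v = card {e \<in> E. v \<in> e}"

definition max_degree :: "'v::finite set set \<Rightarrow> nat" where
  "max_degree E = Max (range (vertex_degree E))"

text \<open>The length of a path or cycle is its number of edges, so a path of length \<open>l\<close> has \<open>l + 1\<close>
  vertices. Subgraphs need not be induced.\<close>

definition has_path_of_length :: "'v::finite set set \<Rightarrow> nat \<Rightarrow> bool" where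
  "has_path_of_length E l \<longleftrightarrow>
     (\<exists>vs. length vs = l + 1 \<and> distinct vs \<and> (\<forall>i<l. {vs ! i, vs ! (i + 1)} \<in> E))"

definition has_cycle_of_length :: "'v::finite set set \<Rightarrow> nat \<Rightarrow> bool" where
  "has_cycle_of_length E l \<longleftrightarrow> l \<ge> 3 \<and>
     (\<exists>vs. length vs = l \<and> distinct vs \<and> (\<forall>i<l. {vs ! i, vs ! ((i + 1) mod l)} \<in> E))"

definition forest :: "'v::finite set set \<Rightarrow> bool" where
  "forest E \<longleftrightarrow> \<not> (\<exists>l. has_cycle_of_length E l)"

definition square_free :: "'v::finite set set \<Rightarrow> bool" where
  "square_free E \<longleftrightarrow> \<not> has_cycle_of_length E 4"

definition girth_at_least :: "nat \<Rightarrow> 'v::finite set set \<Rightarrow> bool" where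
  "girth_at_least g E \<longleftrightarrow> \<not> (\<exists>l<g. has_cycle_of_length E l)"

text \<open>
  A graph is planar if it can be drawn in the plane (here \<^typ>\<open>complex\<close>): vertices are
  distinct points \<open>p v\<close>, and each edge \<open>e\<close> is an arc \<open>\<gamma> e\<close> joining its endpoints that meets no
  other vertex; two different arcs meet at most in vertices.
\<close>

definition planar :: "'v::finite set set \<Rightarrow> bool" where
  "planar E \<longleftrightarrow>
     (\<exists>(p :: 'v \<Rightarrow> complex) (\<gamma> :: 'v set \<Rightarrow> real \<Rightarrow> complex).
        inj p \<and>
        (\<forall>e\<in>E. arc (\<gamma> e) \<and> {pathstart (\<gamma> e), pathfinish (\<gamma> e)} = p ` e \<and>
                path_image (\<gamma> e) \<inter> range p = p ` e) \<and>
        (\<forall>e\<in>E. \<forall>f\<in>E. e \<noteq> f \<longrightarrow> path_image (\<gamma> e) \<inter> path_image (\<gamma> f) \<subseteq> range p))"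


section \<open>Laplacian matrix and its eigenvalues\<close>

definition laplacian :: "'v::finite set set \<Rightarrow> real ^ 'v ^ 'v" where
  "laplacian E = (\<chi> u v. if u = v then real (vertex_degree E u)
                         else if {u, v} \<in> E then -1 else 0)"

definition charpoly :: "real ^ 'n ^ 'n \<Rightarrow> real poly" where
  "charpoly A = det (\<chi> i j. (if i = j then [:0, 1:] else 0) - [:A $ i $ j:])"

text \<open>
  The \<open>i\<close>-th largest eigenvalue (\<open>i = 1, 2, \<dots>\<close>), counted with multiplicity as a root of the
  characteristic polynomial. It is meaningful for symmetric \<open>A\<close> and \<open>1 \<le> i \<le> CARD('n)\<close>: then all
  roots of the characteristic polynomial are real, so that the list has \<open>CARD('n)\<close> entries.
\<close>

definition eigval :: "real ^ 'n ^ 'n \<Rightarrow> nat \<Rightarrow> real" where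
  "eigval A i = rev (sorted_list_of_multiset (proots (charpoly A))) ! (i - 1)"

end

theory Submission
  imports Defs
begin

text \<open>
  Let \<open>P\<close> be the orthogonal projection onto the span of eigenvectors of the \<open>k\<close> largest eigenvalues.
  The sum of these eigenvalues is \<open>trace (P * L)\<close>, that is, the sum of \<open>P u u + P v v - 2 * P u v\<close> over
  all edges \<open>{u, v}\<close>. Only \<open>(P u v)\<^sup>2 \<le> P u u * P v v\<close>, the same inequality for the complementary
  projection, the row identity \<open>(\<Sum>v. (P u v)\<^sup>2) = P u u\<close> and \<open>trace P = k\<close> are used. From them one
  finds vertex weights in \<open>[0, 1]\<close> of total at most \<open>2 * k\<close> such that every edge contributes at most
  the sum of the weights of its ends. So the eigenvalue sum is at most the sum of the degrees over
  some set \<open>U\<close> of at most \<open>2 * k\<close> vertices, hence at most \<open>|E|\<close> plus the number of edges inside \<open>U\<close>, and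
  the extremal function of the graph class finishes the proof. The bound \<open>|E| + k\<^sup>2\<close> and the bound
  \<open>|E| + k * \<Delta>\<close> come from pointwise estimates of the same edge contributions.
\<close>

section \<open>Edge contributions of a projection and their division between the two ends\<close>

section \<open>Orthogonal projections\<close>

text \<open>The weights \<open>2 * P u u\<close> already have total \<open>2 * k\<close> and
  dominate every edge, but they may exceed 1, and the cap at 1 is essential: among weights in
  \<open>[0, 1]\<close> of total \<open>2 * k\<close>, the weighted degree sum is largest for the
  indicator of the \<open>2 * k\<close> vertices of largest degree, and this is where
  \<open>U\<close> comes from. Merely cutting weights down to 1 fails, since an edge between a heavy
  and a light vertex can contribute more than what remains; the part cut off has to be handed to the
  light vertices.

  The constants in the theorem are the extremal functions at \<open>n = 2 * k\<close>:
  \<open>3 * n - 6\<close>, \<open>t * (n - 1) / 2\<close>, \<open>(t - 1) * n / 2\<close>,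
  \<open>n * (1 + sqrt (4 * n - 3)) / 4\<close> and \<open>n * sqrt (n - 1) / 2\<close>.

  The square bound cannot be read off from \<open>U\<close>, because \<open>2 * k\<close> vertices
  may span \<open>k * (2 * k - 1)\<close> edges. There the excess of each contribution over 1 is
  charged to the ends by a formula that depends on the pair, and only the sum of the charges over
  all other vertices is controlled.\<close>

locale orthogonal_projection =
  fixes P :: "'v::finite \<Rightarrow> 'v \<Rightarrow> real" and k :: nat
  assumes sym: "P u v = P v u"
    and idem: "(\<Sum>w\<in>UNIV. P u w * P w v) = P u v"
    and trace: "(\<Sum>u\<in>UNIV. P u u) = real k"
begin

definition X where "X u = 1 - P u u"

lemma row_norm: "(\<Sum>v\<in>UNIV. (P u v)\<^sup>2) = P u u"
proof -
  have "(\<Sum>v\<in>UNIV. (P u v)\<^sup>2) = (\<Sum>v\<in>UNIV. P u v * P v u)"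
    by (intro sum.cong refl) (metis power2_eq_square sym)
  then show ?thesis
    by (simp only: idem)
qed

lemma diag_nonneg: "0 \<le> P u u"
  using sum_nonneg[of UNIV "\<lambda>v. (P u v)\<^sup>2"] row_norm[of u] by simp

lemma row_norm_remove: "(\<Sum>v\<in>UNIV-{u}. (P u v)\<^sup>2) = P u u * X u"
proof -
  have "(\<Sum>v\<in>UNIV. (P u v)\<^sup>2) = (P u u)\<^sup>2 + (\<Sum>v\<in>UNIV-{u}. (P u v)\<^sup>2)"
    by (simp add: sum.remove)
  then show ?thesis
    using row_norm[of u] by (simp add: X_def power2_eq_square right_diff_distrib)
qed

lemma X_nonneg: "0 \<le> X u"
proof -
  have "0 \<le> P u u * X u"
    using sum_nonneg[of "UNIV-{u}" "\<lambda>v. (P u v)\<^sup>2"] row_norm_remove[of u] by simp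
  then show ?thesis
    using diag_nonneg[of u] by (cases "P u u = 0") (auto simp: X_def zero_le_mult_iff)
qed

lemma diag_le_1: "P u u \<le> 1"
  using X_nonneg[of u] by (simp add: X_def)

lemma entry_sq_le: "(P u v)\<^sup>2 \<le> P u u * P v v"
proof -
  have "(P u v)\<^sup>2 = (\<Sum>w\<in>UNIV. P u w * P v w)\<^sup>2"
    by (simp only: idem sym[of v])
  also have "\<dots> \<le> (\<Sum>w\<in>UNIV. (P u w)\<^sup>2) * (\<Sum>w\<in>UNIV. (P v w)\<^sup>2)"
    by (rule Cauchy_Schwarz_ineq_sum)
  finally show ?thesis
    by (simp add: row_norm)
qed

lemma complement: "orthogonal_projection (\<lambda>u v. of_bool (u = v) - P u v) (CARD('v) - k)"
proof
  fix u v
  show "of_bool (u = v) - P u v = of_bool (v = u) - P v u"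
    by (simp add: sym[of u v] eq_commute)
  have "(\<Sum>w\<in>UNIV. (of_bool (u = w) - P u w) * (of_bool (w = v) - P w v))
      = (\<Sum>w\<in>UNIV. (if w = u then of_bool (w = v) - P w v else 0) - (if w = v then P u w else 0)
           + P u w * P w v)"
    by (intro sum.cong) (auto simp: algebra_simps)
  also have "\<dots> = of_bool (u = v) - P u v"
    by (simp add: sum.distrib sum_subtractf idem)
  finally show "(\<Sum>w\<in>UNIV. (of_bool (u = w) - P u w) * (of_bool (w = v) - P w v))
      = of_bool (u = v) - P u v" .
next
  have "(\<Sum>u\<in>UNIV. P u u) \<le> (\<Sum>u\<in>(UNIV::'v set). 1)"
    by (intro sum_mono diag_le_1)
  then have "k \<le> CARD('v)"
    by (simp add: trace)
  then show "(\<Sum>u\<in>UNIV. of_bool (u = u) - P u u) = real (CARD('v) - k)"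
    by (simp add: sum_subtractf trace of_nat_diff)
qed

lemma entry_sq_le_X:
  assumes "u \<noteq> v"
  shows "(P u v)\<^sup>2 \<le> X u * X v"
proof -
  interpret complement: orthogonal_projection "\<lambda>u v. of_bool (u = v) - P u v" "CARD('v) - k"
    by (rule complement)
  show ?thesis
    using complement.entry_sq_le[of u v] assms unfolding X_def by (simp only:) simp
qed

subsection \<open>Splitting the weight of a pair between its endpoints\<close>

text \<open>If \<open>P u u\<close> exceeds \<open>1/2\<close> then the excess \<open>2 * P u u - 1\<close> of \<open>u\<close> is spread over the other
  vertices \<open>v\<close> proportionally to \<open>(P u v)\<^sup>2\<close>, so that the total share stays \<open>2 * k\<close>.
  When \<open>X u = 0\<close> the off-diagonal entries of the row vanish, and so does \<open>spread u v\<close>.\<close>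

definition spread where
  "spread u v = (if P u u > 1/2 \<and> v \<noteq> u then (P u v)\<^sup>2 * (1 / X u - 1 / P u u) else 0)"

definition share where
  "share v = (if P v v > 1/2 then 1 else min 1 (2 * P v v + (\<Sum>u\<in>UNIV. spread u v)))"

lemma spread_nonneg: "0 \<le> spread u v"
proof (cases "X u = 0")
  case True
  then have "u \<noteq> v \<Longrightarrow> (P u v)\<^sup>2 \<le> 0"
    using entry_sq_le_X[of u v] by simp
  then show ?thesis
    by (auto simp: spread_def)
next
  case False
  with X_nonneg[of u] have "0 < X u"
    by simp
  then have "1 / P u u \<le> 1 / X u" if "P u u > 1/2"
    using that by (intro divide_left_mono) (auto simp: X_def)
  then show ?thesis
    by (auto simp: spread_def)
qed

text \<open>The factor \<open>1 / X u - 1 / P u u\<close> is a normalisation: the off-diagonal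
  squares of the row sum to \<open>P u u * X u\<close>, so the row hands out
  \<open>P u u - X u\<close>, which is exactly the excess of \<open>2 * P u u\<close> over 1. For
  \<open>X u = 0\<close> nothing is handed out, hence only an inequality.\<close>

lemma spread_sum: "(\<Sum>v\<in>UNIV. spread u v) \<le> (if P u u > 1/2 then 2 * P u u - 1 else 0)"
proof (cases "P u u > 1/2")
  case True
  have "(\<Sum>v\<in>UNIV. spread u v) = (\<Sum>v\<in>UNIV-{u}. (P u v)\<^sup>2 * (1 / X u - 1 / P u u))"
    using True by (intro sum.mono_neutral_cong_right) (auto simp: spread_def)
  also have "\<dots> = P u u * X u * (1 / X u - 1 / P u u)"
    by (simp add: sum_distrib_right[symmetric] row_norm_remove)
  also have "\<dots> \<le> 2 * P u u - 1"
  proof (cases "X u = 0")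
    case False
    then have "P u u * X u * (1 / X u - 1 / P u u) = P u u - X u"
      using True by (simp add: right_diff_distrib)
    then show ?thesis
      by (simp add: X_def)
  qed (use True in simp)
  finally show ?thesis
    using True by simp
qed (simp add: spread_def)

lemma share_nonneg: "0 \<le> share v"
  using diag_nonneg[of v] by (auto simp: share_def intro!: add_nonneg_nonneg sum_nonneg spread_nonneg)

lemma share_le_1: "share v \<le> 1"
  by (simp add: share_def)

text \<open>Conservation of mass: a heavy vertex drops from \<open>2 * P v v\<close> to 1, and all
  that the light vertices receive is paid from these drops.\<close>

lemma share_sum: "(\<Sum>v\<in>UNIV. share v) \<le> 2 * real k"
proof -
  have "share v \<le> 2 * P v v + (\<Sum>u\<in>UNIV. spread u v) - (if P v v > 1/2 then 2 * P v v - 1 else 0)" for v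
    by (auto simp: share_def intro!: sum_nonneg spread_nonneg)
  then have "(\<Sum>v\<in>UNIV. share v) \<le>
      (\<Sum>v\<in>UNIV. 2 * P v v + (\<Sum>u\<in>UNIV. spread u v) - (if P v v > 1/2 then 2 * P v v - 1 else 0))"
    by (intro sum_mono)
  also have "\<dots> = 2 * real k + (\<Sum>u\<in>UNIV. \<Sum>v\<in>UNIV. spread u v)
      - (\<Sum>v\<in>UNIV. if P v v > 1/2 then 2 * P v v - 1 else 0)"
    by (simp only: sum_subtractf sum.distrib sum_distrib_left[symmetric] trace sum.swap[of spread])
  also have "\<dots> \<le> 2 * real k"
    using sum_mono[of UNIV "\<lambda>u. \<Sum>v\<in>UNIV. spread u v", OF spread_sum] by simp
  finally show ?thesis .
qed

text \<open>The left side is the squared length of the projection of the difference of two unit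
  vectors, whose own squared length is 2. In terms of entries it is the inequality of arithmetic and
  geometric means for the complementary projection.\<close>

lemma weight_le_2:
  assumes "u \<noteq> v"
  shows "P u u + P v v - 2 * P u v \<le> 2"
proof -
  have "(P u v)\<^sup>2 \<le> ((X u + X v) / 2)\<^sup>2"
    using entry_sq_le_X[OF assms] sum_squares_bound[of "X u" "X v"]
    by (simp add: power2_eq_square algebra_simps)
  then have "\<bar>P u v\<bar> \<le> (X u + X v) / 2"
    using X_nonneg[of u] X_nonneg[of v] by (simp add: abs_le_square_iff[symmetric])
  then show ?thesis
    by (simp add: X_def)
qed

lemma two_entry_le: "- (2 * P u v) \<le> P u u + P v v"
proof -
  have "(P u v)\<^sup>2 \<le> ((P u u + P v v) / 2)\<^sup>2"
    using entry_sq_le[of u v] sum_squares_bound[of "P u u" "P v v"]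
    by (simp add: power2_eq_square algebra_simps)
  then have "\<bar>P u v\<bar> \<le> (P u u + P v v) / 2"
    using diag_nonneg[of u] diag_nonneg[of v] by (simp add: abs_le_square_iff[symmetric])
  then show ?thesis
    by simp
qed

lemma weight_le_share_aux:
  assumes "u \<noteq> v" "P u u > 1/2" "\<not> P v v > 1/2"
  shows "P u u + P v v - 2 * P u v \<le> share u + share v"
proof -
  have "P u u + P v v - 2 * P u v - 1 \<le> 2 * P v v + spread u v"
  proof (cases "X u = 0")
    case True
    then have "(P u v)\<^sup>2 \<le> 0"
      using entry_sq_le_X[OF assms(1)] by simp
    then show ?thesis
      using True diag_nonneg[of v] assms by (simp add: spread_def X_def)
  next
    case False
    with X_nonneg[of u] have X: "0 < X u"
      by simp
    \<comment> \<open>Completing the square produces the term \<open>1 / X u\<close> of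
      \<open>spread\<close>. The subtracted term \<open>1 / P u u\<close> is affordable because it
      costs at most one of the two copies of \<open>P v v\<close> in the share of
      \<open>v\<close>.\<close>
    have "0 \<le> (P u v + X u)\<^sup>2 / X u"
      using X by simp
    also have "\<dots> = (P u v)\<^sup>2 / X u + 2 * P u v + X u"
      using X by (simp add: power2_eq_square field_simps)
    finally have 1: "- 2 * P u v - X u \<le> (P u v)\<^sup>2 / X u"
      by simp
    have 2: "(P u v)\<^sup>2 / P u u \<le> P v v"
      using entry_sq_le[of u v] assms(2) by (simp add: field_simps)
    show ?thesis
      using 1 2 assms by (simp add: spread_def right_diff_distrib X_def)
  qed
  also have "spread u v \<le> (\<Sum>w\<in>UNIV. spread w v)"
    by (intro member_le_sum) (auto simp: spread_nonneg)
  finally have "P u u + P v v - 2 * P u v - 1 \<le> 2 * P v v + (\<Sum>w\<in>UNIV. spread w v)"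
    by simp
  then show ?thesis
    using assms weight_le_2[OF assms(1)] by (simp add: share_def)
qed

lemma weight_le_share:
  assumes "u \<noteq> v"
  shows "P u u + P v v - 2 * P u v \<le> share u + share v"
proof -
  consider "P u u > 1/2" "P v v > 1/2" | "P u u > 1/2" "\<not> P v v > 1/2" | "\<not> P u u > 1/2" "P v v > 1/2"
    | "\<not> P u u > 1/2" "\<not> P v v > 1/2"
    by blast
  then show ?thesis
  proof cases
    case 1
    then show ?thesis
      using weight_le_2[OF assms] by (simp add: share_def)
  next
    case 2
    then show ?thesis
      using weight_le_share_aux assms by blast
  next
    case 3
    then show ?thesis
      using weight_le_share_aux[of v u] assms by (simp add: sym[of u v])
  next
    case 4
    have "2 * P w w \<le> share w" if "\<not> P w w > 1/2" for w
      using that sum_nonneg[of UNIV "\<lambda>u. spread u w", OF spread_nonneg] by (simp add: share_def)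
    from this[OF 4(1)] this[OF 4(2)] show ?thesis
      using two_entry_le[of u v] by simp
  qed
qed

text \<open>Off-diagonal entries of a projection are at most \<open>1/2\<close> in absolute value:
  the product of the two bounds on \<open>(P u v)\<^sup>2\<close> splits into
  \<open>P u u * X u\<close> and \<open>P v v * X v\<close>, each at most
  \<open>1/4\<close>.\<close>

lemma weight_le_diag:
  assumes "u \<noteq> v"
  shows "P u u + P v v - 2 * P u v - 1 \<le> P u u + P v v"
proof -
  have quarter: "P w w * X w \<le> 1/4" for w
  proof -
    have "P w w * X w = 1/4 - (P w w - 1/2)\<^sup>2"
      by (simp add: X_def power2_eq_square field_simps)
    then show ?thesis
      by simp
  qed
  have "(P u v)\<^sup>2 * (P u v)\<^sup>2 \<le> (P u u * P v v) * (X u * X v)"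
    using entry_sq_le[of u v] entry_sq_le_X[OF assms] diag_nonneg
    by (intro mult_mono) auto
  also have "\<dots> = (P u u * X u) * (P v v * X v)"
    by simp
  also have "\<dots> \<le> (1/4) * (1/4)"
using quarter by (intro mult_mono) (auto simp: diag_nonneg X_nonneg)
  finally have "((P u v)\<^sup>2)\<^sup>2 \<le> ((1/2)\<^sup>2)\<^sup>2"
    by (simp add: power2_eq_square)
  then have "(P u v)\<^sup>2 \<le> (1/2)\<^sup>2"
    by (rule power2_le_imp_le) simp
  then have "\<bar>P u v\<bar> \<le> 1/2"
    by (simp add: abs_le_square_iff[symmetric])
  then show ?thesis
    by simp
qed

text \<open>The part of the excess of the pair that is charged to \<open>u\<close>. Summed over
  \<open>v\<close>, the first term is governed by the trace and the second by the row norm; the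
  coefficients are balanced so that everything beyond \<open>k * P u u\<close> cancels.\<close>

definition square_share where
  "square_share u v = P u u * P v v * (1 - X u / 2) + (P u v)\<^sup>2 * (P u u / X u + (1 + X u) / 2)"

lemma square_share_nonneg: "0 \<le> square_share u v"
proof -
  have "0 \<le> 1 - X u / 2"
    using diag_nonneg[of u] by (simp add: X_def)
  then show ?thesis
    using diag_nonneg X_nonneg unfolding square_share_def
    by (intro add_nonneg_nonneg mult_nonneg_nonneg) auto
qed

text \<open>For \<open>X u > 0\<close> the sum equals
  \<open>k * P u u - P u u * X u * (k - 2) / 2\<close>, so it is tight at \<open>k = 2\<close>, and
  the sign of the correction explains the assumption on \<open>k\<close>.\<close>

lemma square_share_sum:
  assumes "2 \<le> k"
  shows "(\<Sum>v\<in>UNIV-{u}. square_share u v) \<le> k * P u u"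
proof -
  have "(\<Sum>v\<in>UNIV-{u}. P v v) = k - P u u"
    using trace by (simp add: sum.remove[of UNIV u])
  then have "(\<Sum>v\<in>UNIV-{u}. square_share u v) = P u u * (k - P u u) * (1 - X u / 2)
      + P u u * X u * (P u u / X u + (1 + X u) / 2)"
    by (simp add: square_share_def sum.distrib sum_distrib_left[symmetric]
        sum_distrib_right[symmetric] row_norm_remove)
  also have "\<dots> \<le> P u u * (k - P u u) * (1 - X u / 2) + P u u * (P u u + X u * (1 + X u) / 2)"
  proof -
    have "X u * (P u u / X u + (1 + X u) / 2) \<le> P u u + X u * (1 + X u) / 2"
      using diag_nonneg[of u] by (cases "X u = 0") (simp_all add: distrib_left)
    from mult_left_mono[OF this diag_nonneg[of u]] show ?thesis
      by (simp add: mult.assoc)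
  qed
  also have "\<dots> = k * P u u - P u u * X u * (real k - 2) / 2"
    by (simp add: X_def field_simps)
  also have "\<dots> \<le> k * P u u"
    using assms diag_nonneg[of u] X_nonneg[of u] by simp
  finally show ?thesis .
qed

end

text \<open>For \<open>D \<ge> 1\<close> the first three terms are at least \<open>(p - s)\<^sup>2 / p\<close>. Otherwise, with
  \<open>d = 1 - D\<close>, \<open>g = sqrt p\<close> and \<open>c = s / g\<close>, the sum is at least
  \<open>(c - g)\<^sup>2 - d * c\<^sup>2 + d * (1 + d) / 2\<close>, where \<open>g \<le> (1 - d) / 2\<close>.\<close>

lemma square_share_ineq_aux:
  fixes x y s :: real
  assumes x: "0 \<le> x" "x < 1" and y: "0 \<le> y" "y < 1"
    and s: "s\<^sup>2 \<le> x * y" "s\<^sup>2 \<le> (1 - x) * (1 - y)"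
  defines "p \<equiv> (1 - x) * (1 - y)" and "D \<equiv> (1 - x) + (1 - y)"
  shows "0 \<le> p - 2 * s + s\<^sup>2 * D / p + (x * y - s\<^sup>2) * (x + y) / 2"
proof -
  have p: "0 < p"
    using x y by (simp add: p_def)
  have xy: "x * y = p + (1 - D)"
    by (simp add: p_def D_def algebra_simps)
  show ?thesis
  proof (cases "D \<ge> 1")
    case True
    have "0 \<le> (p - s)\<^sup>2 / p"
      using p by simp
    also have "\<dots> = p - 2 * s + s\<^sup>2 * 1 / p"
      using p by (simp add: power2_eq_square field_simps)
    also have "s\<^sup>2 * 1 / p \<le> s\<^sup>2 * D / p"
      using p True by (intro divide_right_mono mult_left_mono) auto
    finally have "0 \<le> p - 2 * s + s\<^sup>2 * D / p"
      by simp
    moreover have "0 \<le> (x * y - s\<^sup>2) * (x + y) / 2"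
      using x y s by simp
    ultimately show ?thesis
      by linarith
  next
    case False
    define d where "d = 1 - D"
    define g where "g = sqrt p"
    define c where "c = s / g"
    have d: "0 < d" "d \<le> 1"
      using False x y by (auto simp: d_def D_def)
    have g: "0 < g" "g\<^sup>2 = p"
      using p by (auto simp: g_def)
    have sc: "s = c * g"
      using g by (simp add: c_def)
    have c: "c\<^sup>2 \<le> 1"
      using s(2) p by (simp add: c_def power_divide g p_def)
    have "p \<le> ((1 - d) / 2)\<^sup>2"
    proof -
      have "((1 - d) / 2)\<^sup>2 - p = ((x - y) / 2)\<^sup>2"
        by (simp add: p_def d_def D_def power2_eq_square field_simps)
      then show ?thesis
        by (metis diff_ge_0_iff_ge zero_le_power2)
    qed
    then have gd: "g \<le> (1 - d) / 2"
      using d g(2) by (intro power2_le_imp_le[of g]) auto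
    have key: "0 \<le> (c - g)\<^sup>2 - d * c\<^sup>2 + d * (1 + d) / 2"
    proof (cases "c\<^sup>2 \<le> (1 + d) / 2 \<or> c < 0")
      case True
      then show ?thesis
      proof
        assume "c\<^sup>2 \<le> (1 + d) / 2"
        from mult_left_mono[OF this, of d] d have "d * c\<^sup>2 \<le> d * (1 + d) / 2"
          by simp
        then show ?thesis
          using zero_le_power2[of "c - g"] by linarith
      next
        assume "c < 0"
        then have "c\<^sup>2 \<le> (c - g)\<^sup>2"
          using g by (simp add: abs_le_square_iff[symmetric])
        moreover have "d * c\<^sup>2 \<le> c\<^sup>2"
          using d by (simp add: mult_left_le_one_le)
        ultimately show ?thesis
          using d by (simp add: add_nonneg_nonneg)
      qed
    next
      case False
      then have "(1/2)\<^sup>2 \<le> c\<^sup>2" "0 \<le> c"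
        using d by (auto simp: power2_eq_square)
      then have "1/2 \<le> c"
        using power2_le_imp_le by blast
      \<comment> \<open>Since \<open>g\<close> lies below \<open>(1 - d) / 2\<close> and
        \<open>c\<close> above it, the square is smallest at the largest admissible
        \<open>g\<close>; inserting that value leaves a sum of visibly nonnegative terms.\<close>
      then have "(c - (1 - d) / 2)\<^sup>2 \<le> (c - g)\<^sup>2"
        using gd d by (intro power_mono) auto
      moreover have "(c - (1 - d) / 2)\<^sup>2 - d * c\<^sup>2 + d * (1 + d) / 2
          = (1 - d) * (c - 1/2)\<^sup>2 + d * (1 + 3 * d) / 4"
        by (simp add: power2_eq_square field_simps)
      moreover have "0 \<le> (1 - d) * (c - 1/2)\<^sup>2 + d * (1 + 3 * d) / 4"
        using d by (intro add_nonneg_nonneg) auto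
      ultimately show ?thesis
        by linarith
    qed
    have "s\<^sup>2 = c\<^sup>2 * p"
      by (simp add: sc power_mult_distrib g)
    then have "p - 2 * s + s\<^sup>2 * D / p + (x * y - s\<^sup>2) * (x + y) / 2
        = p - 2 * s + c\<^sup>2 * D + (p + (1 - D) - c\<^sup>2 * p) * (x + y) / 2"
      using p by (simp add: xy)
    also have "\<dots> = g\<^sup>2 - 2 * (c * g) + c\<^sup>2 * (1 - d) + (g\<^sup>2 * (1 - c\<^sup>2) + d) * (1 + d) / 2"
      unfolding g(2)[symmetric] sc by (simp add: d_def D_def algebra_simps)
    also have "\<dots> = (c - g)\<^sup>2 - d * c\<^sup>2 + d * (1 + d) / 2 + g\<^sup>2 * (1 - c\<^sup>2) * (1 + d) / 2"
      by (simp add: power2_eq_square field_simps)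
    also have "\<dots> \<ge> 0"
      using key c d by simp
    finally show ?thesis .
  qed
qed

context orthogonal_projection
begin

lemma weight_le_square_share:
  assumes "u \<noteq> v"
  shows "P u u + P v v - 2 * P u v - 1 \<le> square_share u v + square_share v u"
proof -
  define x y s where "x = P u u" and "y = P v v" and "s = - P u v"
  have xy: "0 \<le> x" "x \<le> 1" "0 \<le> y" "y \<le> 1" and s: "s\<^sup>2 \<le> x * y" "s\<^sup>2 \<le> (1 - x) * (1 - y)"
    using diag_nonneg diag_le_1 entry_sq_le[of u v] entry_sq_le_X[OF assms]
    by (auto simp: x_def y_def s_def X_def)
  have rhs: "square_share u v + square_share v u = x * y * (1 - (1 - x) / 2) + s\<^sup>2 * (x / (1 - x) + (1 + (1 - x)) / 2)
      + (x * y * (1 - (1 - y) / 2) + s\<^sup>2 * (y / (1 - y) + (1 + (1 - y)) / 2))"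
    by (simp add: square_share_def x_def y_def s_def X_def sym[of v u] mult.commute)
  show ?thesis
  proof (cases "x = 1 \<or> y = 1")
    case True
    \<comment> \<open>A diagonal entry 1 makes a denominator in \<open>square_share\<close> zero, so
      that the quotient is 0 by convention. This is harmless because the factor \<open>s\<close>
      vanishes too.\<close>
    then have "s = 0"
      using s by auto
    then show ?thesis
      unfolding rhs using True xy
      by (auto simp: x_def[symmetric] y_def[symmetric] s_def field_simps)
  next
    case False
    with xy have lt: "x < 1" "y < 1"
      by auto
    then have *: "x / (1 - x) + y / (1 - y) + 2 = ((1 - x) + (1 - y)) / ((1 - x) * (1 - y))"
      by (simp add: divide_simps) (simp add: algebra_simps)
    have "square_share u v + square_share v u - (x + y + 2 * s - 1)
        = (1 - x) * (1 - y) - 2 * s + s\<^sup>2 * (((1 - x) + (1 - y)) / ((1 - x) * (1 - y)))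
          + (x * y - s\<^sup>2) * (x + y) / 2"
      unfolding rhs *[symmetric] by (simp add: field_simps)
    with square_share_ineq_aux[OF xy(1) lt(1) xy(3) lt(2) s] show ?thesis
      by (simp add: x_def y_def s_def)
  qed
qed

end

section \<open>Degree sums: from fractional weights to a vertex set, and the resulting trace
  bounds\<close>

section \<open>Degree sums\<close>

definition adj :: "'v set set \<Rightarrow> 'v \<Rightarrow> 'v \<Rightarrow> bool" where
  "adj E u v \<longleftrightarrow> {u, v} \<in> E"

lemma adj_commute: "adj E u v \<longleftrightarrow> adj E v u"
  by (simp add: adj_def insert_commute)

lemma adj_irrefl: "simple_graph E \<Longrightarrow> \<not> adj E u u"
  by (auto simp: simple_graph_def adj_def)

lemma vertex_degree_altdef:
  assumes "simple_graph E"
  shows "vertex_degree E u = card {v. adj E u v}"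
proof -
  have "bij_betw (\<lambda>v. {u, v}) {v. adj E u v} {e\<in>E. u \<in> e}"
  proof (rule bij_betwI')
    fix x y assume "x \<in> {v. adj E u v}" "y \<in> {v. adj E u v}"
    then show "({u, x} = {u, y}) = (x = y)"
      by (auto simp: doubleton_eq_iff)
  next
    fix e assume e: "e \<in> {e \<in> E. u \<in> e}"
    then have "card e = 2"
      using assms by (auto simp: simple_graph_def)
    then obtain a b where "e = {a, b}"
      by (auto simp: card_2_iff)
    with e show "\<exists>x\<in>{v. adj E u v}. e = {u, x}"
      by (auto simp: adj_def insert_commute)
  qed (auto simp: adj_def)
  then show ?thesis
    by (simp add: vertex_degree_def bij_betw_same_card)
qed

lemma sum_adj:
  assumes "simple_graph E"
  shows "(\<Sum>v\<in>UNIV. if adj E u v then c else 0) = real (vertex_degree E u) * c"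
  by (simp add: vertex_degree_altdef[OF assms] sum.If_cases)

lemma sum_adj_fst:
  assumes "simple_graph E"
  shows "(\<Sum>u\<in>UNIV. \<Sum>v\<in>UNIV. if adj E u v then f u else 0) = (\<Sum>u\<in>UNIV. real (vertex_degree E u) * f u)"
  by (simp add: sum_adj[OF assms])

lemma sum_adj_snd:
  assumes "simple_graph E"
  shows "(\<Sum>u\<in>UNIV. \<Sum>v\<in>UNIV. if adj E u v then f v else 0) = (\<Sum>u\<in>UNIV. real (vertex_degree E u) * f u)"
  using sum_adj_fst[OF assms, of f] by (subst sum.swap) (simp add: adj_commute)

lemma degree_sum_le:
  assumes "simple_graph E"
  shows "(\<Sum>u\<in>U. vertex_degree E u) \<le> card E + card {e\<in>E. e \<subseteq> U}"
proof -
  have "(\<Sum>u\<in>U. vertex_degree E u) = (\<Sum>u\<in>U. \<Sum>e\<in>E. if u \<in> e then 1 else 0)"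
    by (simp add: vertex_degree_def sum.If_cases Int_def)
  also have "\<dots> = (\<Sum>e\<in>E. \<Sum>u\<in>U. if u \<in> e then 1 else 0)"
    by (rule sum.swap)
  also have "\<dots> = (\<Sum>e\<in>E. card (U \<inter> e))"
    by (simp add: sum.If_cases)
  also have "\<dots> \<le> (\<Sum>e\<in>E. 1 + (if e \<subseteq> U then 1 else 0))"
  proof (rule sum_mono)
    fix e assume "e \<in> E"
    then have e: "card e = 2"
      using assms by (simp add: simple_graph_def)
    show "card (U \<inter> e) \<le> 1 + (if e \<subseteq> U then 1 else 0)"
    proof (cases "e \<subseteq> U")
      case True
      then show ?thesis
        using e by (simp add: Int_absorb1)
    next
      case False
      then have "card (U \<inter> e) < card e"
        by (intro psubset_card_mono) auto
      then show ?thesis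
        using e False by simp
    qed
  qed
  also have "\<dots> = card E + card {e\<in>E. e \<subseteq> U}"
    unfolding sum.distrib by (simp add: sum.If_cases Int_def)
  finally show ?thesis .
qed

text \<open>Covers the cases in which \<open>U\<close> is too small for the general estimates:
  \<open>k = 1\<close> in the square bound and fewer than three vertices in the planar
  bound.\<close>

lemma card_induced_le_1:
  fixes E :: "'v::finite set set"
  assumes "simple_graph E" "card U \<le> 2"
  shows "card {e\<in>E. e \<subseteq> U} \<le> 1"
proof -
  have "e = U" if "e \<in> E" "e \<subseteq> U" for e
    using that assms by (intro card_seteq) (auto simp: simple_graph_def)
  then have "card {e\<in>E. e \<subseteq> U} \<le> card {U}"
    by (intro card_mono) auto
  then show ?thesis
    by simp
qed

lemma degree_sum_eq:
  assumes "simple_graph E"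
  shows "(\<Sum>u\<in>UNIV. vertex_degree E u) = 2 * card E"
proof -
  have "(\<Sum>u\<in>UNIV. vertex_degree E u) = (\<Sum>u\<in>UNIV. \<Sum>e\<in>E. if u \<in> e then 1 else 0)"
    by (simp add: vertex_degree_def sum.If_cases Int_def)
  also have "\<dots> = (\<Sum>e\<in>E. \<Sum>u\<in>UNIV. if u \<in> e then 1 else 0)"
    by (rule sum.swap)
  also have "\<dots> = (\<Sum>e\<in>E. card e)"
    by (simp add: sum.If_cases)
  also have "\<dots> = (\<Sum>e\<in>E. 2)"
    using assms by (intro sum.cong) (auto simp: simple_graph_def)
  finally show ?thesis
    by simp
qed

text \<open>The weight is best placed on the \<open>m\<close> vertices of largest value. Instead of
  an exchange argument, every vertex is compared with the threshold \<open>\<theta>\<close>, the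
  value of the first vertex outside \<open>U\<close>: relative to it, a vertex of \<open>U\<close>
  gains at most by weight 1, and any other vertex at most by weight 0.\<close>

lemma fractional_degree_sum:
  fixes q :: "'v::finite \<Rightarrow> real" and d :: "'v \<Rightarrow> nat"
  assumes q: "\<And>u. 0 \<le> q u" "\<And>u. q u \<le> 1" "(\<Sum>u\<in>UNIV. q u) \<le> real m"
  obtains U where "card U \<le> m" "(\<Sum>u\<in>UNIV. q u * real (d u)) \<le> (\<Sum>u\<in>U. real (d u))"
proof (cases "CARD('v) \<le> m")
  case True
  have "(\<Sum>u\<in>UNIV. q u * real (d u)) \<le> (\<Sum>u\<in>UNIV. real (d u))"
    using q by (intro sum_mono) (simp add: mult_left_le_one_le)
  then show ?thesis
    using that[of UNIV] True by simp
next
  case False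
  obtain us0 where us0: "set us0 = (UNIV :: 'v set)" "distinct us0"
    using finite_distinct_list[OF finite[of "UNIV :: 'v set"]] by metis
  define us where "us = rev (sort_key d us0)"
  have us: "set us = UNIV" "distinct us"
    using us0 by (simp_all add: us_def)
  have len: "length us = CARD('v)"
    using distinct_card[OF us(2)] us(1) by simp
  have srt: "sorted_wrt (\<lambda>u v. d v \<le> d u) us"
  proof -
    have "sorted_wrt (\<lambda>x y. y \<le> x) (rev (map d (rev us)))"
      unfolding sorted_wrt_rev by (simp add: us_def)
    then show ?thesis
      by (simp add: rev_map sorted_wrt_map)
  qed
  define U where "U = set (take m us)"
  define \<theta> where "\<theta> = d (us ! m)"
  have cU: "card U = m"
    using False us len by (simp add: U_def distinct_card)
  have ge: "\<theta> \<le> d u" if "u \<in> U" for u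
  proof -
    from that obtain i where "i < m" "u = us ! i"
      using False len by (auto simp: U_def in_set_conv_nth)
    then show ?thesis
      using sorted_wrt_nth_less[OF srt, of i m] False len by (simp add: \<theta>_def)
  qed
  have le: "d u \<le> \<theta>" if "u \<notin> U" for u
  proof -
    from us obtain i where i: "i < length us" "u = us ! i"
      by (metis in_set_conv_nth UNIV_I)
    with that have "m \<le> i"
      by (metis U_def in_set_conv_nth length_take min_less_iff_conj nth_take not_le)
    then show ?thesis
      using sorted_wrt_nth_less[OF srt, of m i] i by (cases "i = m") (auto simp: \<theta>_def)
  qed
  have "(\<Sum>u\<in>UNIV. q u * real (d u)) \<le> (\<Sum>u\<in>UNIV. q u * \<theta> + (if u \<in> U then real (d u) - \<theta> else 0))"
  proof (rule sum_mono)
    fix u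
    show "q u * real (d u) \<le> q u * \<theta> + (if u \<in> U then real (d u) - \<theta> else 0)"
    proof (cases "u \<in> U")
      case True
      have "q u * (real (d u) - \<theta>) \<le> 1 * (real (d u) - \<theta>)"
        using q ge[OF True] by (intro mult_right_mono) auto
      then show ?thesis
        using True by (simp add: algebra_simps)
    next
      case False
      then show ?thesis
        using q le[OF False] by (simp add: mult_left_mono)
    qed
  qed
  also have "\<dots> = (\<Sum>u\<in>UNIV. q u) * \<theta> + ((\<Sum>u\<in>U. real (d u)) - m * \<theta>)"
    by (simp add: sum.distrib sum.If_cases sum_distrib_right[symmetric] sum_subtractf cU)
  also have "\<dots> \<le> (\<Sum>u\<in>U. real (d u))"
    using mult_right_mono[OF q(3), of \<theta>] by simp
  finally show ?thesis
    using that[of U] cU by simp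
qed

context orthogonal_projection
begin

text \<open>The trace of the product of the projection and the Laplacian of \<open>E\<close>.\<close>

definition laplacian_trace where
  "laplacian_trace E = (\<Sum>u\<in>UNIV. \<Sum>v\<in>UNIV. if adj E u v then P u u + P v v - 2 * P u v else 0) / 2"

lemma laplacian_trace_le_share_sum:
  assumes "simple_graph E"
  shows "laplacian_trace E \<le> (\<Sum>u\<in>UNIV. share u * vertex_degree E u)"
proof -
  have "2 * laplacian_trace E \<le> (\<Sum>u\<in>UNIV. \<Sum>v\<in>UNIV. (if adj E u v then share u else 0) + (if adj E u v then share v else 0))"
    unfolding laplacian_trace_def using adj_irrefl[OF assms]
    by (auto intro!: sum_mono weight_le_share)
  also have "\<dots> = 2 * (\<Sum>u\<in>UNIV. share u * vertex_degree E u)"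
    unfolding sum.distrib sum_adj_fst[OF assms] sum_adj_snd[OF assms] by (simp add: mult.commute)
  finally show ?thesis
    by simp
qed

lemma laplacian_trace_le_induced:
  assumes "simple_graph E"
  obtains U where "card U \<le> 2 * k" "laplacian_trace E \<le> card E + card {e\<in>E. e \<subseteq> U}"
proof -
  obtain U where U: "card U \<le> 2 * k" "(\<Sum>u\<in>UNIV. share u * real (vertex_degree E u)) \<le> (\<Sum>u\<in>U. real (vertex_degree E u))"
    using fractional_degree_sum[of share "2 * k" "vertex_degree E"] share_nonneg share_le_1 share_sum by auto
  have "laplacian_trace E \<le> real (\<Sum>u\<in>U. vertex_degree E u)"
    using laplacian_trace_le_share_sum[OF assms] U by simp
  also have "\<dots> \<le> real (card E + card {e\<in>E. e \<subseteq> U})"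
    using degree_sum_le[OF assms] by (intro of_nat_mono)
  finally show ?thesis
    using that U by simp
qed

text \<open>Removes 1 from the contribution of each edge, so that a pointwise bound on the excess is
  enough. The factor 2 is due to counting ordered pairs.\<close>

lemma laplacian_trace_minus_card:
  assumes "simple_graph E"
  shows "2 * (laplacian_trace E - card E)
    = (\<Sum>u\<in>UNIV. \<Sum>v\<in>UNIV. if adj E u v then P u u + P v v - 2 * P u v - 1 else 0)"
proof -
  have "2 * real (card E) = (\<Sum>u\<in>UNIV. real (vertex_degree E u) * 1)"
    using degree_sum_eq[OF assms] by (simp flip: of_nat_sum)
  also have "\<dots> = (\<Sum>u\<in>UNIV. \<Sum>v\<in>UNIV. if adj E u v then 1 else 0)"
    using sum_adj_fst[OF assms, of "\<lambda>_. 1"] by simp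
  finally have "2 * (laplacian_trace E - card E) = (\<Sum>u\<in>UNIV. \<Sum>v\<in>UNIV.
      (if adj E u v then P u u + P v v - 2 * P u v else 0) - (if adj E u v then 1 else 0))"
    unfolding sum_subtractf by (simp add: laplacian_trace_def)
  also have "\<dots> = (\<Sum>u\<in>UNIV. \<Sum>v\<in>UNIV. if adj E u v then P u u + P v v - 2 * P u v - 1 else 0)"
    by (intro sum.cong refl) simp
  finally show ?thesis .
qed

lemma laplacian_trace_le_max_degree:
  assumes "simple_graph E" and deg: "\<And>u. vertex_degree E u \<le> \<Delta>"
  shows "laplacian_trace E \<le> card E + real k * real \<Delta>"
proof -
  have "2 * (laplacian_trace E - card E) \<le> (\<Sum>u\<in>UNIV. \<Sum>v\<in>UNIV. (if adj E u v then P u u else 0) + (if adj E u v then P v v else 0))"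
    unfolding laplacian_trace_minus_card[OF assms(1)] using adj_irrefl[OF assms(1)]
    by (intro sum_mono) (metis add.right_neutral order_refl weight_le_diag)
  also have "\<dots> = 2 * (\<Sum>u\<in>UNIV. vertex_degree E u * P u u)"
    unfolding sum.distrib sum_adj_fst[OF assms(1)] sum_adj_snd[OF assms(1)] by (simp add: mult.commute)
  also have "(\<Sum>u\<in>UNIV. vertex_degree E u * P u u) \<le> (\<Sum>u\<in>UNIV. \<Delta> * P u u)"
    using deg diag_nonneg by (intro sum_mono mult_right_mono) auto
  also have "\<dots> = k * \<Delta>"
    by (simp add: sum_distrib_left[symmetric] trace)
  finally show ?thesis
    by simp
qed

lemma laplacian_trace_le_square:
  assumes "simple_graph E" "1 \<le> k"
  shows "laplacian_trace E \<le> card E + real k * real k"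
proof (cases "k = 1")
  case True
  obtain U where U: "card U \<le> 2 * k" "laplacian_trace E \<le> card E + card {e\<in>E. e \<subseteq> U}"
    using laplacian_trace_le_induced[OF assms(1)] by blast
  show ?thesis
    using U card_induced_le_1[OF assms(1), of U] True by simp
next
  case False
  have "2 * (laplacian_trace E - card E) \<le> (\<Sum>u\<in>UNIV. \<Sum>v\<in>UNIV.
      (if v \<noteq> u then square_share u v else 0) + (if v \<noteq> u then square_share v u else 0))"
    unfolding laplacian_trace_minus_card[OF assms(1)] using adj_irrefl[OF assms(1)] square_share_nonneg
    by (auto intro!: sum_mono weight_le_square_share)
  also have "\<dots> = (\<Sum>u\<in>UNIV. \<Sum>v\<in>UNIV. if v \<noteq> u then square_share u v else 0)
      + (\<Sum>u\<in>UNIV. \<Sum>v\<in>UNIV. if v \<noteq> u then square_share v u else 0)"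
    by (simp only: sum.distrib)
  also have "(\<Sum>u\<in>UNIV. \<Sum>v\<in>UNIV. if v \<noteq> u then square_share v u else 0)
      = (\<Sum>u\<in>UNIV. \<Sum>v\<in>UNIV. if v \<noteq> u then square_share u v else 0)"
    by (subst sum.swap) (simp add: eq_commute)
  also have "(\<Sum>u\<in>UNIV. \<Sum>v\<in>UNIV. if v \<noteq> u then square_share u v else 0)
      = (\<Sum>u\<in>UNIV. \<Sum>v\<in>UNIV-{u}. square_share u v)"
    by (intro sum.cong refl sum.mono_neutral_cong_right) auto
  also have "\<dots> \<le> (\<Sum>u\<in>UNIV. k * P u u)"
    using False assms(2) by (intro sum_mono square_share_sum) auto
  also have "\<dots> = k * k"
    by (simp add: sum_distrib_left[symmetric] trace)
  finally show ?thesis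
    by simp
qed

end

section \<open>The spectral theorem, and the sum of the largest eigenvalues as a trace\<close>

section \<open>Eigenvalues of symmetric matrices\<close>

text \<open>Rayleigh: a unit vector of the subspace that maximises the quadratic form is an eigenvector.\<close>

lemma eigenvector_in_invariant_subspace:
  fixes f :: "'a::euclidean_space \<Rightarrow> 'a"
  assumes f: "linear f" and adj: "\<And>x y. x \<bullet> f y = f x \<bullet> y"
    and S: "subspace S" "f ` S \<subseteq> S" "S \<noteq> {0}"
  obtains x c where "x \<in> S" "norm x = 1" "f x = c *\<^sub>R x"
proof -
  have "compact (S \<inter> sphere 0 1)"
    by (simp add: closed_Int_compact closed_subspace S)
  moreover obtain z where "z \<in> S" "z \<noteq> 0"
    using S subspace_0 by blast
  then have "z /\<^sub>R norm z \<in> S \<inter> sphere 0 1"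
    using S by (simp add: subspace_scale)
  then have "S \<inter> sphere 0 1 \<noteq> {}"
    by blast
  moreover have "continuous_on (S \<inter> sphere 0 1) (\<lambda>x. x \<bullet> f x)"
    using f by (intro continuous_intros linear_continuous_on) (simp add: linear_conv_bounded_linear)
  ultimately obtain x where x: "x \<in> S" "norm x = 1"
    and max: "\<And>y. y \<in> S \<Longrightarrow> norm y = 1 \<Longrightarrow> y \<bullet> f y \<le> x \<bullet> f x"
    using continuous_attains_sup[of "S \<inter> sphere 0 1" "\<lambda>x. x \<bullet> f x"]
    by (metis IntI IntD1 IntD2 mem_sphere_0)
  define c where "c = x \<bullet> f x"
  have le: "y \<bullet> f y \<le> c * (y \<bullet> y)" if "y \<in> S" for y
  proof (cases "y = 0")
    case False
    have "(y /\<^sub>R norm y) \<bullet> f (y /\<^sub>R norm y) \<le> c"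
      unfolding c_def using S that False by (intro max) (auto simp: subspace_scale)
    then have "(y \<bullet> f y) / (norm y)\<^sup>2 \<le> c"
      by (simp add: linear_scale[OF f] power2_eq_square divide_inverse mult_ac)
    then show ?thesis
      using False by (simp add: power2_norm_eq_inner divide_le_eq)
  qed (simp add: linear_0[OF f])
  define y where "y = f x - c *\<^sub>R x"
  have y: "y \<in> S"
    using x S by (auto simp: y_def intro!: subspace_diff subspace_scale)
  have xx: "x \<bullet> x = 1"
    using x by (simp add: norm_eq_1)
  have yx: "y \<bullet> x = 0"
    unfolding y_def inner_diff_left inner_scaleR_left xx by (simp add: c_def inner_commute)
  have yfx: "y \<bullet> f x = y \<bullet> y"
  proof -
    have "f x = y + c *\<^sub>R x"
      by (simp add: y_def)
    then have "y \<bullet> f x = y \<bullet> y + c * (y \<bullet> x)"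
      by (metis inner_add_right inner_scaleR_right)
    then show ?thesis
      by (simp add: yx)
  qed
  define b where "b = c * (y \<bullet> y) - y \<bullet> f y"
  \<comment> \<open>Moving from the maximiser \<open>x\<close> in the direction of the residual
    \<open>y\<close> gains \<open>2 * t * (y \<bullet> y)\<close> to first order and loses only a
    quadratic term. The values \<open>t = 1\<close> for \<open>b \<le> 0\<close> and
    \<open>t = (y \<bullet> y) / b\<close> otherwise then force \<open>y = 0\<close>.\<close>
  have ineq: "2 * t * (y \<bullet> y) \<le> t\<^sup>2 * b" for t
  proof -
    have le': "(x + t *\<^sub>R y) \<bullet> f (x + t *\<^sub>R y) \<le> c * ((x + t *\<^sub>R y) \<bullet> (x + t *\<^sub>R y))"
      using x y S by (intro le subspace_add subspace_scale) auto
    have "x \<bullet> f y = y \<bullet> y"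
      using adj[of x y] yfx by (simp add: inner_commute)
    then have *: "(x + t *\<^sub>R y) \<bullet> f (x + t *\<^sub>R y) = c + 2 * t * (y \<bullet> y) + t\<^sup>2 * (y \<bullet> f y)"
      unfolding linear_add[OF f] linear_scale[OF f] inner_add_left inner_add_right
        inner_scaleR_left inner_scaleR_right yfx
      by (simp add: c_def power2_eq_square distrib_left)
    have **: "(x + t *\<^sub>R y) \<bullet> (x + t *\<^sub>R y) = 1 + t\<^sup>2 * (y \<bullet> y)"
      unfolding inner_add_left inner_add_right inner_scaleR_left inner_scaleR_right xx yx
        inner_commute[of x y] by (simp add: power2_eq_square)
    show ?thesis
      using le' unfolding * ** by (simp add: b_def algebra_simps)
  qed
  have "y \<bullet> y = 0"
  proof (rule ccontr)
    assume "y \<bullet> y \<noteq> 0"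
    then have pos: "0 < y \<bullet> y"
      by simp
    show False
    proof (cases "b \<le> 0")
      case True
      then show False
        using ineq[of 1] pos by simp
    next
      case False
      then have "(y \<bullet> y) * (y \<bullet> y) \<le> 0"
        using ineq[of "(y \<bullet> y) / b"] by (simp add: power2_eq_square field_simps)
      then show False
        using mult_pos_pos[OF pos pos] by linarith
    qed
  qed
  then have "f x = c *\<^sub>R x"
    by (simp add: y_def)
  with x show thesis
    using that by blast
qed

text \<open>A largest orthonormal set of eigenvectors is taken. If it had fewer than
  \<open>CARD('n)\<close> elements, its orthogonal complement would be a nonzero invariant subspace
  and would supply one more eigenvector.\<close>

lemma orthonormal_eigenbasis:
  fixes A :: "real^'n^'n"
  assumes sym: "transpose A = A"
  obtains q :: "'n \<Rightarrow> real^'n" and d :: "'n \<Rightarrow> real"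
  where "\<And>i j. q i \<bullet> q j = of_bool (i = j)" "\<And>i. A *v q i = d i *\<^sub>R q i"
proof -
  define good where "good B \<longleftrightarrow> pairwise orthogonal B \<and> (\<forall>x\<in>B. norm x = 1 \<and> (\<exists>c. A *v x = c *\<^sub>R x))"
    for B :: "(real^'n) set"
  have indep: "independent B" if "good B" for B
    using that by (intro pairwise_orthogonal_independent) (auto simp: good_def)
  have bound: "finite B \<and> card B \<le> CARD('n)" if "good B" for B
    using independent_bound[OF indep[OF that]] by simp
  have "good {}"
    by (simp add: good_def)
  then obtain B where B: "good B" and max: "\<And>B'. good B' \<Longrightarrow> card B' \<le> card B"
    using ex_has_greatest_nat[of good "{}" card "Suc CARD('n)"] bound by (metis le_imp_less_Suc)
  have "card B = CARD('n)"
  proof (rule ccontr)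
    assume "card B \<noteq> CARD('n)"
    with bound[OF B] have "card B < CARD('n)"
      by simp
    then have "dim B < DIM(real^'n)"
      using dim_span_eq_card_independent[OF indep[OF B]] by simp
    then obtain z where z: "z \<noteq> 0" "\<And>y. y \<in> span B \<Longrightarrow> orthogonal z y"
      by (metis orthogonal_to_subspace_exists)
    define S where "S = B\<^sup>\<bottom>"
    have adj: "x \<bullet> (A *v y) = (A *v x) \<bullet> y" for x y
    proof -
      have "x v* A = transpose A *v x"
        by (rule transpose_matrix_vector[symmetric])
      then show ?thesis
        using dot_lmul_matrix[of x A y] unfolding sym by (simp only:)
    qed
    have inv: "(*v) A ` S \<subseteq> S"
    proof clarsimp
      fix x assume x: "x \<in> S"
      show "A *v x \<in> S"
        unfolding S_def orthogonal_comp_def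
      proof clarify
        fix y assume y: "y \<in> B"
        then obtain c where c: "A *v y = c *\<^sub>R y"
          using B by (auto simp: good_def)
        have "y \<bullet> x = 0"
          using x y by (simp add: S_def orthogonal_comp_def orthogonal_def)
        then show "orthogonal y (A *v x)"
          by (simp add: orthogonal_def adj c)
      qed
    qed
    have "z \<in> S"
      using z by (auto simp: S_def orthogonal_comp_def orthogonal_commute span_base)
    then have ne: "S \<noteq> {0}"
      using z by auto
    have "subspace S"
      unfolding S_def by (rule subspace_orthogonal_comp)
    then obtain x c where x: "x \<in> S" "norm x = 1" "A *v x = c *\<^sub>R x"
      using eigenvector_in_invariant_subspace[OF matrix_vector_mul_linear adj _ inv ne] by metis
    have "x \<notin> B"
      using x by (auto simp: S_def orthogonal_comp_def orthogonal_def norm_eq_1)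
    have "good (insert x B)"
      using B x by (auto simp: good_def pairwise_insert S_def orthogonal_comp_def orthogonal_commute)
    from max[OF this] show False
      using \<open>x \<notin> B\<close> bound[OF B] by simp
  qed
  then obtain q where q: "bij_betw q (UNIV :: 'n set) B"
    using bound[OF B] by (metis finite_same_card_bij finite)
  have qB: "q i \<in> B" for i
    using q by (auto simp: bij_betw_def)
  have "q i \<bullet> q j = of_bool (i = j)" for i j
  proof (cases "i = j")
    case True
    then show ?thesis
      using B qB by (simp add: good_def norm_eq_1[symmetric])
  next
    case False
    then have "q i \<noteq> q j"
      using q by (auto simp: bij_betw_def inj_on_def)
    then show ?thesis
      using B qB False by (auto simp: good_def pairwise_def orthogonal_def)
  qed
  moreover have "\<exists>d. \<forall>i. A *v q i = d i *\<^sub>R q i"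
    using B qB unfolding good_def by (intro choice) blast
  ultimately show thesis
    using that by blast
qed

text \<open>Links the eigenbasis to \<open>eigval\<close>, which is defined by roots. Over
  polynomials, the eigenvector equations read \<open>R ** M = N ** R\<close> with \<open>N\<close>
  diagonal; \<open>det R\<close> squares to 1 and can be cancelled.\<close>

lemma charpoly_orthonormal_eigenbasis:
  fixes A :: "real^'n^'n" and q :: "'n \<Rightarrow> real^'n"
  assumes q: "\<And>i j. q i \<bullet> q j = of_bool (i = j)" and eig: "\<And>i. A *v q i = d i *\<^sub>R q i"
    and sym: "transpose A = A"
  shows "charpoly A = (\<Prod>i\<in>UNIV. [:- d i, 1:])"
proof -
  define R :: "real poly^'n^'n" where "R = (\<chi> i j. [:q i $ j:])"
  define M :: "real poly^'n^'n" where "M = (\<chi> i j. (if i = j then [:0, 1:] else 0) - [:A $ i $ j:])"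
  define N :: "real poly^'n^'n" where "N = (\<chi> i j. if i = j then [:- d i, 1:] else 0)"
  have const_sum: "(\<Sum>k\<in>K. [:g k:]) = [:\<Sum>k\<in>K. g k:]" for g :: "'n \<Rightarrow> real" and K
    by (induction K rule: infinite_finite_induct) auto
  have "R ** transpose R = mat 1"
    using q by (auto simp: vec_eq_iff matrix_matrix_mult_def transpose_def R_def mat_def
        inner_vec_def const_sum one_pCons)
  then have "det R * det R = 1"
    by (metis det_I det_mul det_transpose)
  then have R: "det R \<noteq> 0"
    by auto
  have "R ** M = N ** R"
  proof -
    have "(\<Sum>k\<in>UNIV. q i $ k * A $ k $ j) = d i * q i $ j" for i j
    proof -
      have "A $ k $ j = A $ j $ k" for k
        unfolding sym[THEN arg_cong, of "\<lambda>A. A $ k $ j", symmetric] by (simp add: transpose_def)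
      then have "(\<Sum>k\<in>UNIV. q i $ k * A $ k $ j) = (A *v q i) $ j"
        by (simp only: matrix_vector_mult_def vec_lambda_beta mult.commute[of "q i $ _"])
      then show ?thesis
        by (simp add: eig)
    qed
    moreover have "(R ** M) $ i $ j = [:0, q i $ j:] - [:\<Sum>k\<in>UNIV. q i $ k * A $ k $ j:]" for i j
    proof -
      have "(R ** M) $ i $ j = (\<Sum>k\<in>UNIV. (if k = j then [:0, q i $ k:] else 0) - [:q i $ k * A $ k $ j:])"
        unfolding matrix_matrix_mult_def by (auto intro!: sum.cong simp: R_def M_def)
      then show ?thesis
        by (simp add: sum_subtractf const_sum del: diff_pCons)
    qed
    moreover have "(N ** R) $ i $ j = [:- d i * q i $ j, q i $ j:]" for i j
    proof -
      have "(N ** R) $ i $ j = (\<Sum>k\<in>UNIV. if k = i then [:- d i * q i $ j, q i $ j:] else 0)"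
        unfolding matrix_matrix_mult_def vec_lambda_beta
        by (rule sum.cong[OF refl]) (simp add: R_def N_def mult.commute)
      then show ?thesis
        by simp
    qed
    ultimately show ?thesis
      by (simp add: vec_eq_iff)
  qed
  then have "det R * det M = det N * det R"
    by (metis det_mul)
  then have "det M = det N"
    using R by (simp add: mult.commute)
  also have "det N = (\<Prod>i\<in>UNIV. N $ i $ i)"
    by (rule det_diagonal) (simp add: N_def)
  finally show ?thesis
    by (simp add: charpoly_def M_def N_def)
qed

text \<open>\<open>P\<close> is the sum of the rank-one projections onto \<open>q i\<close> for the
  first \<open>k\<close> indices \<open>i\<close>, so the double sum collapses to the sum of
  \<open>q i \<bullet> (A *v q i)\<close>, that is, of the eigenvalues \<open>d i\<close>.\<close>

lemma eigval_sum_eq_trace: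
  fixes A :: "real^'n^'n"
  assumes sym: "transpose A = A" and k: "k \<le> CARD('n)"
  obtains P where "orthogonal_projection P k"
    "(\<Sum>i = 1..k. eigval A i) = (\<Sum>u\<in>UNIV. \<Sum>v\<in>UNIV. A $ u $ v * P u v)"
proof -
  obtain q :: "'n \<Rightarrow> real^'n" and d
    where q: "\<And>i j. q i \<bullet> q j = of_bool (i = j)" and eig: "\<And>i. A *v q i = d i *\<^sub>R q i"
    by (rule orthonormal_eigenbasis[OF sym]) blast
  obtain us0 where us0: "set us0 = (UNIV :: 'n set)" "distinct us0"
    using finite_distinct_list[OF finite[of "UNIV :: 'n set"]] by metis
  \<comment> \<open>Sorting the indices rather than the eigenvalues settles ties once: the
    decreasing list of roots is \<open>map d us\<close>, and its first \<open>k\<close> entries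
    belong to definite eigenvectors.\<close>
  define us where "us = rev (sort_key d us0)"
  have us: "set us = UNIV" "distinct us"
    using us0 by (simp_all add: us_def)
  have len: "length us = CARD('n)"
    using distinct_card[OF us(2)] us(1) by simp
  have "proots (charpoly A) = (\<Sum>i\<in>UNIV. {#d i#})"
    unfolding charpoly_orthonormal_eigenbasis[OF q eig sym] by (subst proots_prod) auto
  also have "\<dots> = mset (map d us)"
  proof -
    have "mset us = mset_set UNIV"
      using us mset_set_set[OF us(2)] by simp
    then show ?thesis
      by (simp add: sum_unfold_sum_mset)
  qed
  also have "sorted_list_of_multiset \<dots> = sort (map d us)"
    by (rule sorted_list_of_multiset_mset)
  also have "\<dots> = map d (rev us)"
    by (intro properties_for_sort) (auto simp: us_def)
  finally have "rev (sorted_list_of_multiset (proots (charpoly A))) = map d us"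
    by (simp add: rev_map)
  then have eigval: "eigval A i = d (us ! (i - 1))" if "i \<in> {1..k}" for i
    unfolding eigval_def using that k len by (simp only:) (auto intro!: nth_map)
  define K where "K = set (take k us)"
  have cK: "card K = k"
    using us len k by (simp add: K_def distinct_card)
  have "(\<Sum>i = 1..k. eigval A i) = (\<Sum>i = 1..k. d (us ! (i - 1)))"
    by (intro sum.cong refl eigval)
  also have "\<dots> = (\<Sum>i<k. d (us ! i))"
    by (rule sum.reindex_bij_witness[of _ Suc "\<lambda>i. i - 1"]) auto
  also have "\<dots> = (\<Sum>i\<in>K. d i)"
  proof (rule sum.reindex_bij_betw)
    show "bij_betw ((!) us) {..<k} K"
    proof -
      have "bij_betw ((!) (take k us)) {..<k} K"
        using us len k by (intro bij_betw_nth) (auto simp: K_def)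
      then show ?thesis
        by (rule bij_betw_cong[THEN iffD1, rotated]) simp
    qed
  qed
  finally have S: "(\<Sum>i = 1..k. eigval A i) = (\<Sum>i\<in>K. d i)" .
  define P where "P u v = (\<Sum>i\<in>K. q i $ u * q i $ v)" for u v
  have dot: "(\<Sum>w\<in>UNIV. q i $ w * q j $ w) = of_bool (i = j)" for i j
    using q[of i j] by (simp add: inner_vec_def)
  have "orthogonal_projection P k"
  proof
    show "P u v = P v u" for u v
      by (simp add: P_def mult.commute)
    show "(\<Sum>w\<in>UNIV. P u w * P w v) = P u v" for u v
    proof -
      have "(\<Sum>w\<in>UNIV. P u w * P w v)
          = (\<Sum>w\<in>UNIV. \<Sum>i\<in>K. \<Sum>j\<in>K. q i $ u * q j $ v * (q i $ w * q j $ w))"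
        by (simp add: P_def sum_product mult_ac)
      also have "\<dots> = (\<Sum>i\<in>K. \<Sum>j\<in>K. \<Sum>w\<in>UNIV. q i $ u * q j $ v * (q i $ w * q j $ w))"
        by (subst sum.swap) (intro sum.cong refl sum.swap)
      also have "\<dots> = P u v"
        by (simp add: sum_distrib_left[symmetric] dot P_def of_bool_def if_distrib sum.delta' cong: if_cong)
      finally show ?thesis .
    qed
    have "(\<Sum>u\<in>UNIV. P u u) = (\<Sum>i\<in>K. 1)"
      unfolding P_def by (subst sum.swap) (simp add: dot)
    then show "(\<Sum>u\<in>UNIV. P u u) = real k"
      by (simp add: cK)
  qed
  moreover have "(\<Sum>u\<in>UNIV. \<Sum>v\<in>UNIV. A $ u $ v * P u v) = (\<Sum>i\<in>K. d i)"
  proof -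
    have "(\<Sum>u\<in>UNIV. \<Sum>v\<in>UNIV. A $ u $ v * P u v)
        = (\<Sum>u\<in>UNIV. \<Sum>i\<in>K. \<Sum>v\<in>UNIV. q i $ u * (A $ u $ v * q i $ v))"
      unfolding P_def sum_distrib_left
      by (rule sum.cong[OF refl], subst sum.swap) (simp add: mult_ac)
    also have "\<dots> = (\<Sum>i\<in>K. \<Sum>u\<in>UNIV. q i $ u * (A *v q i) $ u)"
      by (subst sum.swap) (simp add: matrix_vector_mult_def sum_distrib_left)
    also have "\<dots> = (\<Sum>i\<in>K. d i)"
      by (simp add: eig mult.left_commute sum_distrib_left[symmetric] dot)
    finally show ?thesis .
  qed
  ultimately show thesis
    using that S by simp
qed

lemma eigval_laplacian_sum:
  fixes E :: "'v::finite set set"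
  assumes E: "simple_graph E" and k: "k \<le> CARD('v)"
  obtains P where "orthogonal_projection P k"
    "(\<Sum>i = 1..k. eigval (laplacian E) i) = orthogonal_projection.laplacian_trace P E"
proof -
  have "transpose (laplacian E) = laplacian E"
    unfolding vec_eq_iff
  proof (intro allI)
    fix u v
    show "transpose (laplacian E) $ u $ v = laplacian E $ u $ v"
      unfolding transpose_def laplacian_def vec_lambda_beta insert_commute[of v u "{}"] by auto
  qed
  then obtain P where P: "orthogonal_projection P k"
    and S: "(\<Sum>i = 1..k. eigval (laplacian E) i) = (\<Sum>u\<in>UNIV. \<Sum>v\<in>UNIV. laplacian E $ u $ v * P u v)"
    using eigval_sum_eq_trace[OF _ k, of "laplacian E"] by blast
  interpret orthogonal_projection P k
    by (rule P)
  have "(\<Sum>u\<in>UNIV. \<Sum>v\<in>UNIV. laplacian E $ u $ v * P u v)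
      = (\<Sum>u\<in>UNIV. \<Sum>v\<in>UNIV. (if v = u then real (vertex_degree E u) * P u u else 0) - (if adj E u v then P u v else 0))"
    using adj_irrefl[OF E] by (intro sum.cong refl) (auto simp: laplacian_def adj_def)
  also have "\<dots> = (\<Sum>u\<in>UNIV. real (vertex_degree E u) * P u u) - (\<Sum>u\<in>UNIV. \<Sum>v\<in>UNIV. if adj E u v then P u v else 0)"
    by (simp add: sum_subtractf)
  also have "\<dots> = laplacian_trace E"
  proof -
    have "2 * laplacian_trace E = (\<Sum>u\<in>UNIV. \<Sum>v\<in>UNIV. (if adj E u v then P u u else 0)
        + (if adj E u v then P v v else 0) - 2 * (if adj E u v then P u v else 0))"
      unfolding laplacian_trace_def by (auto intro!: sum.cong)
    also have "\<dots> = 2 * ((\<Sum>u\<in>UNIV. real (vertex_degree E u) * P u u) - (\<Sum>u\<in>UNIV. \<Sum>v\<in>UNIV. if adj E u v then P u v else 0))"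
      unfolding sum_subtractf sum.distrib sum_adj_fst[OF E] sum_adj_snd[OF E] sum_distrib_left[symmetric]
      by simp
    finally show ?thesis
      by simp
  qed
  finally show thesis
    using that P S by simp
qed

section \<open>At most 3n - 6 edges in a plane drawing, by the theorems of Jordan and
  Janiszewski\<close>

section \<open>Planar graphs\<close>

text \<open>Otherwise the inverse of the arc would map a nonempty open part of the plane
  continuously and injectively into the line, against invariance of dimension. This is why every
  nonempty open set contains a point off the drawing.\<close>

lemma interior_arc_image:
  fixes g :: "real \<Rightarrow> complex"
  assumes "arc g"
  shows "interior (path_image g) = {}"
proof (rule ccontr)
  assume ne: "interior (path_image g) \<noteq> {}"
  obtain h where h: "homeomorphism {0..1} (path_image g) g h"
    using homeomorphism_arc[OF assms] by blast
  have "continuous_on (interior (path_image g)) h"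
    using h interior_subset by (metis continuous_on_subset homeomorphism_def)
  moreover have "inj_on h (interior (path_image g))"
  proof (rule inj_on_inverseI[where g = g])
    show "g (h z) = z" if "z \<in> interior (path_image g)" for z
      using homeomorphism_apply2[OF h] interior_subset that by blast
  qed
  ultimately have "dim (UNIV :: complex set) \<le> dim (UNIV :: real set)"
    using ne by (intro invariance_of_dimension_subspaces[of UNIV "interior (path_image g)" UNIV h]) auto
  then show False
    by simp
qed

lemma interior_Union_closed_empty:
  assumes "finite \<F>" "\<And>S. S \<in> \<F> \<Longrightarrow> closed S \<and> interior S = {}"
  shows "interior (\<Union>\<F>) = {}"
  using assms
proof (induction \<F>)
  case (insert S \<F>)
  then have "interior (S \<union> \<Union>\<F>) = interior S"
    by (intro interior_closed_Un_empty_interior) auto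
  with insert show ?case
    by simp
qed simp

lemma connected_component_Un_connected_complement:
  fixes a b :: complex
  assumes "compact S" "compact T" "connected (S \<inter> T)" "connected (- T)"
    and "connected_component (- S) a b" "a \<notin> T" "b \<notin> T"
  shows "connected_component (- (S \<union> T)) a b"
proof (rule Janiszewski[OF assms(1) compact_imp_closed[OF assms(2)] assms(3,5)])
  show "connected_component (- T) a b"
    using assms(4,6,7) connected_component_def by blast
qed

text \<open>Meant for a closed curve \<open>J\<close> with \<open>S\<close> one of its sides: points
  on the same side are not separated by \<open>J\<close>, so they are separated by \<open>K\<close>
  and \<open>J\<close> together only if \<open>K\<close> alone separates them.\<close>

lemma connected_component_same_side:
  fixes a b :: complex
  assumes "compact K" "closed J" "connected (K \<inter> J)"
    and "connected_component (- K) a b" "connected S" "S \<subseteq> - J" "a \<in> S" "b \<in> S"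
  shows "connected_component (- (K \<union> J)) a b"
proof (rule Janiszewski[OF assms(1-4)])
  show "connected_component (- J) a b"
    using assms(5-8) connected_component_def by blast
qed

text \<open>The vertex set is a parameter because the edge bound is needed for the subgraph induced
  on \<open>U\<close>, whose drawing is a restriction of the given one.\<close>

locale plane_drawing =
  fixes V :: "'v set" and E :: "'v set set" and p :: "'v \<Rightarrow> complex" and \<gamma> :: "'v set \<Rightarrow> real \<Rightarrow> complex"
  assumes finV: "finite V"
    and edge: "e \<in> E \<Longrightarrow> e \<subseteq> V \<and> card e = 2"
    and inj: "inj_on p V"
    and arc: "e \<in> E \<Longrightarrow> arc (\<gamma> e)"
    and ends: "e \<in> E \<Longrightarrow> {pathstart (\<gamma> e), pathfinish (\<gamma> e)} = p ` e"
    and verts: "e \<in> E \<Longrightarrow> path_image (\<gamma> e) \<inter> p ` V = p ` e"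
    and cross: "e \<in> E \<Longrightarrow> f \<in> E \<Longrightarrow> e \<noteq> f \<Longrightarrow> path_image (\<gamma> e) \<inter> path_image (\<gamma> f) \<subseteq> p ` V"
begin

abbreviation img where "img e \<equiv> path_image (\<gamma> e)"

definition skel where "skel W F = p ` W \<union> (\<Union>e\<in>F. img e)"

lemma finE: "finite E"
proof (rule finite_subset)
  show "E \<subseteq> Pow V"
    using edge by auto
qed (simp add: finV)

lemma img_compact: "e \<in> E \<Longrightarrow> compact (img e)"
  by (simp add: arc arc_imp_path compact_path_image)

lemma img_Int:
  assumes "e \<in> E" "f \<in> E" "e \<noteq> f"
  shows "img e \<inter> img f = p ` (e \<inter> f)"
proof
  show "img e \<inter> img f \<subseteq> p ` (e \<inter> f)"
  proof
    fix z assume z: "z \<in> img e \<inter> img f"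
    then have "z \<in> p ` V"
      using cross[OF assms] by auto
    with z have "z \<in> p ` e" "z \<in> p ` f"
      using verts assms by blast+
    then show "z \<in> p ` (e \<inter> f)"
      using inj_on_image_Int[OF inj, of e f] edge assms by simp
  qed
  show "p ` (e \<inter> f) \<subseteq> img e \<inter> img f"
    using verts assms by blast
qed

lemma skel_compact: "W \<subseteq> V \<Longrightarrow> F \<subseteq> E \<Longrightarrow> compact (skel W F)"
  unfolding skel_def using finV finE img_compact
  by (intro compact_Un[OF finite_imp_compact compact_UN]) (auto intro: finite_subset)

lemma skel_closed: "W \<subseteq> V \<Longrightarrow> F \<subseteq> E \<Longrightarrow> closed (skel W F)"
  by (simp add: skel_compact compact_imp_closed)

lemma skel_interior: "interior (skel V E) = {}"
proof -
  have "interior (\<Union>(insert (p ` V) (img ` E))) = {}"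
    using finE finV arc
    by (intro interior_Union_closed_empty)
      (auto simp: finite_imp_closed empty_interior_finite interior_arc_image img_compact compact_imp_closed)
  then show ?thesis
    by (simp add: skel_def)
qed

lemma skel_mono: "F \<subseteq> G \<Longrightarrow> skel W F \<subseteq> skel W G"
  by (auto simp: skel_def)

lemma skel_insert: "skel W (insert e F) = skel W F \<union> img e"
  by (auto simp: skel_def)

lemma img_Int_skel:
  assumes "e \<in> E" "F \<subseteq> E" "e \<notin> F"
  shows "skel V F \<inter> img e = p ` e"
proof -
  have "img f \<inter> img e \<subseteq> p ` e" if "f \<in> F" for f
    using img_Int[of e f] assms that by blast
  then show ?thesis
    using verts[OF assms(1)] by (auto simp: skel_def)
qed

lemma interior_point:
  assumes "e \<in> E"
  obtains z where "z \<in> img e" "z \<notin> p ` V"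
proof -
  have "uncountable (img e)"
    using arc[OF assms] by (simp add: arc_imp_simple_path simple_path_image_uncountable)
  then have "\<not> img e \<subseteq> p ` V"
    using finV by (meson countable_finite countable_subset finite_imageI)
  then show thesis
    using that by blast
qed

lemma connected_img_interior:
  assumes "e \<in> E"
  shows "connected (img e - p ` V)"
proof -
  have "img e - p ` V = img e - p ` e"
    using verts[OF assms] by blast
  also have "\<dots> = img e - {pathstart (\<gamma> e), pathfinish (\<gamma> e)}"
    using ends[OF assms] by simp
  also have "connected \<dots>"
    using arc[OF assms] by (intro connected_simple_path_endless) (simp add: arc_imp_simple_path)
  finally show ?thesis .
qed

subsection \<open>Reachability\<close>

definition reach where "reach F = (\<lambda>x y. {x, y} \<in> F)\<^sup>*\<^sup>*"

lemma reach_refl [simp]: "reach F x x"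
  by (simp add: reach_def)

lemma reach_sym: "reach F x y \<Longrightarrow> reach F y x"
  unfolding reach_def
  by (rule sympD[OF symp_rtranclp]) (auto simp: symp_def insert_commute)

lemma reach_trans: "reach F x y \<Longrightarrow> reach F y z \<Longrightarrow> reach F x z"
  unfolding reach_def by (rule rtranclp_trans)

lemma reach_edge: "{x, y} \<in> F \<Longrightarrow> reach F x y"
  unfolding reach_def by auto

lemma reach_mono: "F \<subseteq> G \<Longrightarrow> reach F x y \<Longrightarrow> reach G x y"
  unfolding reach_def by (erule rtranclp_mono[THEN predicate2D, rotated]) auto

lemma path_component_edge:
  assumes "e \<in> E" "x \<in> e" "y \<in> e"
  shows "path_component (img e) (p x) (p y)"
proof -
  have *: "p x \<in> img e" "p y \<in> img e"
    using verts[OF assms(1)] assms by blast+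
  have "path_connected (img e)"
    using arc[OF assms(1)] by (simp add: arc_imp_path path_connected_path_image)
  with * show ?thesis
    unfolding path_connected_component by blast
qed

lemma reach_path_component:
  assumes "reach F x y" "F \<subseteq> E" "x \<in> V"
  shows "path_component (skel V F) (p x) (p y)"
  using assms(1) unfolding reach_def
proof (induction rule: rtranclp_induct)
  case base
  then show ?case
    using assms by (simp add: path_component_refl skel_def)
next
  case (step y z)
  have "img {y, z} \<subseteq> skel V F"
    using step by (auto simp: skel_def)
  moreover have "path_component (img {y, z}) (p y) (p z)"
    using step assms by (intro path_component_edge) auto
  ultimately show ?case
    using step.IH path_component_of_subset path_component_trans by blast
qed

text \<open>The closed curve consists of the new edge and an arc inside the old drawing that joins
  its ends; a topological arc suffices, and no path of the graph is selected. The old drawing meets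
  the curve exactly in this arc, hence in a connected set, as Janiszewski's theorem demands.\<close>

lemma reach_loop:
  assumes "{x, y} \<in> E" "F \<subseteq> E" "{x, y} \<notin> F" "reach F x y"
  obtains c where "simple_path c" "pathfinish c = pathstart c" "img {x, y} \<subseteq> path_image c"
    "path_image c \<subseteq> skel V F \<union> img {x, y}" "connected (skel V F \<inter> path_image c)"
proof -
  have xy: "x \<in> V" "y \<in> V" "x \<noteq> y"
    using edge[OF assms(1)] by auto
  then have "p x \<noteq> p y"
    using inj by (auto simp: inj_on_def)
  have "path_component (skel V F) (p x) (p y)"
    using reach_path_component assms xy by blast
  then obtain h where h: "arc h" "path_image h \<subseteq> skel V F" "pathstart h = p x" "pathfinish h = p y"
    using path_contains_arc[of _ "p x" "p y"] \<open>p x \<noteq> p y\<close> unfolding path_component_def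
    by (metis order_trans)
  have pe: "{pathstart (\<gamma> {x, y}), pathfinish (\<gamma> {x, y})} = {p x, p y}"
    using ends[OF assms(1)] by simp
  obtain g where g: "arc g" "path_image g = img {x, y}" "pathstart g = p y" "pathfinish g = p x"
  proof (cases "pathstart (\<gamma> {x, y}) = p y")
    case True
    then show thesis
      using that[of "\<gamma> {x, y}"] pe arc[OF assms(1)] \<open>p x \<noteq> p y\<close> by (auto simp: doubleton_eq_iff)
  next
    case False
    then show thesis
      using that[of "reversepath (\<gamma> {x, y})"] pe arc[OF assms(1)]
      by (auto simp: doubleton_eq_iff arc_reversepath)
  qed
  have sk: "skel V F \<inter> img {x, y} = {p x, p y}"
    using img_Int_skel[OF assms(1-3)] by simp
  have "simple_path (h +++ g)"
    using h g sk by (intro simple_path_join_loop) auto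
  moreover have im: "path_image (h +++ g) = path_image h \<union> img {x, y}"
    using h g by (simp add: path_image_join)
  moreover have "skel V F \<inter> path_image (h +++ g) = path_image h"
  proof -
    have "{p x, p y} \<subseteq> path_image h"
      using h pathstart_in_path_image[of h] pathfinish_in_path_image[of h] by auto
    then show ?thesis
      using h(2) sk unfolding im by blast
  qed
  moreover have "connected (path_image h)"
    using h by (simp add: arc_imp_path connected_path_image)
  ultimately show thesis
    using that[of "h +++ g"] h g by auto
qed

subsection \<open>Each edge that closes a cycle splits a face\<close>

text \<open>One point for each of several faces of the drawing of \<open>F\<close>. The points avoid
  the drawing of all of \<open>E\<close>, so they stay usable when \<open>F\<close> grows.\<close>

definition separated where
  "separated A F \<longleftrightarrow> finite A \<and> A \<inter> skel V E = {}
     \<and> (\<forall>a\<in>A. \<forall>b\<in>A. a \<noteq> b \<longrightarrow> \<not> connected_component (- skel V F) a b)"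

lemma separated_mono:
  assumes "separated A F" "F \<subseteq> G"
  shows "separated A G"
proof -
  have "- skel V G \<subseteq> - skel V F"
    using skel_mono[OF assms(2)] by auto
  then show ?thesis
    using assms(1) connected_component_of_subset unfolding separated_def by blast
qed

lemma open_avoids_skel: "open U \<Longrightarrow> U \<noteq> {} \<Longrightarrow> \<exists>u\<in>U. u \<notin> skel V E"
  using interior_maximal[of U "skel V E"] skel_interior by (metis subsetI subset_empty)

text \<open>An interior point \<open>z\<close> of the new edge lies in a face \<open>W\<close> of
  the old drawing and on the closed curve through the edge. Both sides of the curve accumulate at
  \<open>z\<close>, so \<open>W\<close> contains a point of each side. These two points replace the
  points of \<open>A\<close> in \<open>W\<close>, of which there is at most one.\<close>

lemma separated_split:
  assumes e: "{x, y} \<in> E" "F \<subseteq> E" "{x, y} \<notin> F" "reach F x y" and A: "separated A F"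
  obtains A' where "separated A' (insert {x, y} F)" "card A < card A'"
proof -
  obtain c where c: "simple_path c" "pathfinish c = pathstart c" "img {x, y} \<subseteq> path_image c"
    "path_image c \<subseteq> skel V F \<union> img {x, y}" "connected (skel V F \<inter> path_image c)"
    using reach_loop[OF e] by blast
  obtain inner outer where io: "inner \<inter> outer = {}" "inner \<union> outer = - path_image c"
    "open inner" "open outer" "frontier inner = path_image c" "frontier outer = path_image c"
    using Jordan_curve[OF c(1,2)] by metis
  obtain z where z: "z \<in> img {x, y}" "z \<notin> p ` V"
    using interior_point[OF e(1)] by blast
  have zF: "z \<notin> skel V F"
    using img_Int_skel[OF e(1-3)] z edge[OF e(1)] by blast
  define W where "W = connected_component_set (- skel V F) z"
  have oW: "open W"
    unfolding W_def using skel_closed[of V F] e by (intro open_connected_component) auto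
  have zW: "z \<in> W"
    using zF by (simp add: W_def connected_component_refl_eq)
  have meet: "\<exists>a\<in>W \<inter> I. a \<notin> skel V E" if "open I" "frontier I = path_image c" for I
  proof (rule open_avoids_skel)
    have "z \<in> closure I"
      using that z c by (auto simp: frontier_def)
    then show "W \<inter> I \<noteq> {}"
      using oW zW closure_iff_nhds_not_empty[of z I] by blast
  qed (use oW that in auto)
  obtain a where a: "a \<in> W" "a \<in> inner" "a \<notin> skel V E"
    using meet[of inner] io by blast
  obtain b where b: "b \<in> W" "b \<in> outer" "b \<notin> skel V E"
    using meet[of outer] io by blast
  define A' where "A' = insert a (insert b (A - W))"
  have ab: "a \<noteq> b"
    using a b io by blast
  have same: "connected_component (- skel V F) u v" if "u \<in> W" "v \<in> W" for u v
    using that unfolding W_def mem_Collect_eq using connected_component_sym connected_component_trans by metis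
  have "\<not> connected_component (- skel V (insert {x, y} F)) a b"
  proof
    assume "connected_component (- skel V (insert {x, y} F)) a b"
    moreover have "- skel V (insert {x, y} F) \<subseteq> inner \<union> outer"
      using c(4) io(2) unfolding skel_insert by blast
    ultimately obtain T where "connected T" "T \<subseteq> inner \<union> outer" "a \<in> T" "b \<in> T"
      unfolding connected_component_def by blast
    then show False
      using connectedD[of T inner outer] io a b by blast
  qed
  moreover have "\<not> connected_component (- skel V (insert {x, y} F)) u v" if "u \<in> W" "v \<notin> W" for u v
  proof
    assume "connected_component (- skel V (insert {x, y} F)) u v"
    then have "connected_component (- skel V F) u v"
      by (rule connected_component_of_subset) (auto simp: skel_insert)
    then show False
      using that unfolding W_def mem_Collect_eq using connected_component_trans by metis
  qed
  moreover have "separated A (insert {x, y} F)"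
    using separated_mono[OF A] by blast
  moreover have "connected_component (- skel V (insert {x, y} F)) u v
      \<longleftrightarrow> connected_component (- skel V (insert {x, y} F)) v u" for u v
    using connected_component_sym by metis
  ultimately have "\<not> connected_component (- skel V (insert {x, y} F)) u v"
    if "u \<in> A'" "v \<in> A'" "u \<noteq> v" for u v
    using that a(1) b(1) unfolding A'_def separated_def by (metis Diff_iff insert_iff)
  moreover have "finite A'" "A' \<inter> skel V E = {}"
    using A a b by (auto simp: A'_def separated_def)
  ultimately have "separated A' (insert {x, y} F)"
    unfolding separated_def by blast
  moreover have "card A < card A'"
  proof -
    have "finite A"
      using A by (simp add: separated_def)
    have "u = v" if "u \<in> A \<inter> W" "v \<in> A \<inter> W" for u v
      using that same A unfolding separated_def by blast
    then have "card (A \<inter> W) \<le> 1"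
      using \<open>finite A\<close> by (simp add: card_le_Suc0_iff_eq)
    moreover have "card A = card (A \<inter> W) + card (A - W)"
      using card_Int_Diff[OF \<open>finite A\<close>, of W] by simp
    moreover have "card A' = card (A - W) + 2"
      using \<open>finite A\<close> ab a b by (simp add: A'_def)
    ultimately show ?thesis
      by simp
  qed
  ultimately show thesis
    using that by blast
qed

text \<open>Euler's inequality: \<open>A\<close> picks points in different faces and \<open>X\<close> meets every connected component,
  so each added edge either increases \<open>A\<close> or allows a vertex to be dropped from \<open>X\<close>.\<close>

lemma many_separated_points:
  assumes "V \<noteq> {}"
  obtains A where "separated A E" "card E + 2 \<le> card A + card V"
proof -
  have "\<exists>A X. separated A F \<and> X \<subseteq> V \<and> X \<noteq> {} \<and> (\<forall>v\<in>V. \<exists>x\<in>X. reach F x v)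
      \<and> card F + card X + 1 \<le> card A + card V" if "F \<subseteq> E" for F
    using finite_subset[OF that finE] that
  proof (induction F)
    case empty
    obtain u where "u \<notin> skel V E"
      using open_avoids_skel[of UNIV] by auto
    then have "separated {u} {}"
      by (simp add: separated_def)
    then show ?case
      using assms by (intro exI[of _ "{u}"] exI[of _ V]) (auto intro: reach_refl)
  next
    case (insert e F)
    then obtain A X where A: "separated A F" and X: "X \<subseteq> V" "X \<noteq> {}" "\<forall>v\<in>V. \<exists>x\<in>X. reach F x v"
      and card: "card F + card X + 1 \<le> card A + card V"
      by auto
    obtain x y where xy: "e = {x, y}"
      using edge[of e] insert.prems by (auto simp: card_2_iff)
    have V: "x \<in> V" "y \<in> V"
      using edge[of e] insert.prems xy by auto
    have mono: "reach F u v \<Longrightarrow> reach (insert e F) u v" for u v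
      by (rule reach_mono[of F]) auto
    show ?case
    proof (cases "reach F x y")
      case True
      obtain A' where "separated A' (insert e F)" "card A < card A'"
        using separated_split[OF _ _ _ True A] insert xy by auto
      moreover have "\<forall>v\<in>V. \<exists>x\<in>X. reach (insert e F) x v"
        using X(3) mono by blast
      moreover have "card (insert e F) = Suc (card F)"
        using insert.hyps by simp
      ultimately show ?thesis
        using X(1,2) card by (intro exI[of _ A'] exI[of _ X]) auto
    next
      case False
      obtain x' where x': "x' \<in> X" "reach F x' x"
        using X(3) V(1) by blast
      obtain y' where y': "y' \<in> X" "reach F y' y"
        using X(3) V(2) by blast
      have "x' \<noteq> y'"
        using reach_trans[OF reach_sym[OF x'(2)]] y'(2) False by metis
      have xy': "reach (insert e F) x' y'"
      proof -
        have "reach (insert e F) x y"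
          by (intro reach_edge) (simp add: xy)
        then show ?thesis
          using reach_trans[OF mono[OF x'(2)] reach_trans[OF _ mono[OF reach_sym[OF y'(2)]]]] by metis
      qed
      have "\<exists>x\<in>X - {y'}. reach (insert e F) x v" if v: "v \<in> V" for v
      proof -
        obtain w where w: "w \<in> X" "reach F w v"
          using X(3) v by blast
        show ?thesis
        proof (cases "w = y'")
          case True
          then have "reach (insert e F) x' v"
            using reach_trans[OF xy'] mono[OF w(2)] by simp
          then show ?thesis
            using x' \<open>x' \<noteq> y'\<close> by blast
        qed (use w mono in blast)
      qed
      moreover have "separated A (insert e F)"
        using separated_mono[OF A] by blast
      moreover have "card (X - {y'}) + 1 = card X"
        using y' finite_subset[OF X(1) finV] by (metis Suc_eq_plus1 card_Suc_Diff1)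
      moreover have "card (insert e F) = Suc (card F)"
        using insert.hyps by simp
      moreover have "X - {y'} \<subseteq> V" "X - {y'} \<noteq> {}"
        using X(1) x'(1) \<open>x' \<noteq> y'\<close> by auto
      ultimately show ?thesis
        using card by (intro exI[of _ A] exI[of _ "X - {y'}"]) auto
    qed
  qed
  from this[of E] obtain A X where "separated A E" "X \<subseteq> V" "X \<noteq> {}" "card E + card X + 1 \<le> card A + card V"
    by auto
  \<comment> \<open>One representative always remains; it turns the 1 of the invariant into the 2 of
    Euler's formula.\<close>
  moreover from this have "0 < card X"
    using finite_subset[OF _ finV] by (simp add: card_gt_0_iff)
  ultimately show thesis
    using that by force
qed

subsection \<open>Incidence of edges and faces\<close>

text \<open>The vertices are removed because a face that touches an edge only at an end should not
  count as incident with it.\<close>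

definition borders where
  "borders a e \<longleftrightarrow> e \<in> E \<and> closure (connected_component_set (- skel V E) a) \<inter> (img e - p ` V) \<noteq> {}"

text \<open>The frontier of the face lies on the vertices and the bordering edges \<open>G\<close>.
  With at most two edges in \<open>G\<close>, these do not separate the plane: a single arc does
  not, and two distinct edges share at most one point, so Janiszewski's theorem applies. Finitely
  many further points do not matter. Hence the face fills the complement of \<open>skel V G\<close>,
  which leaves no room for a third edge.\<close>

lemma face_borders_three:
  assumes a: "a \<notin> skel V E" and E: "3 \<le> card E"
  shows "3 \<le> card {e. borders a e}"
proof (rule ccontr)
  assume less: "\<not> 3 \<le> card {e. borders a e}"
  define G where "G = {e. borders a e}"
  have G: "G \<subseteq> E" "card G \<le> 2"
    using less by (auto simp: G_def borders_def)
  define f where "f = connected_component_set (- skel V E) a"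
  have "frontier f \<subseteq> skel V E"
    unfolding f_def
    using frontier_of_connected_component_subset[of "- skel V E" a] frontier_complement
      frontier_subset_closed[OF skel_closed[OF order_refl order_refl]] by auto
  then have fr: "frontier f \<subseteq> skel V G"
    unfolding skel_def G_def borders_def f_def frontier_def by blast
  have con: "connected (- (\<Union>e\<in>G. img e))"
  proof -
    have "finite G"
      using G finE finite_subset by blast
    have "card G = 0 \<or> card G = 1 \<or> card G = 2"
      using G(2) by linarith
    then consider "G = {}" | e where "G = {e}" | e e' where "G = {e, e'}" "e \<noteq> e'"
      using \<open>finite G\<close> unfolding card_1_singleton_iff One_nat_def[symmetric] card_2_iff
      by (metis card_0_eq card_1_singletonE card_2_iff)
    then show ?thesis
    proof cases
      case 2
      then show ?thesis
        using connected_arc_complement[OF arc[of e]] G by simp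
    next
      case 3
      have "connected (img e \<inter> img e')"
      proof -
        have "card (e \<inter> e') < card e"
        proof (rule psubset_card_mono)
          show "finite e"
            using edge[of e] G 3 by (auto intro: card_ge_0_finite)
          have "e \<inter> e' \<noteq> e"
          proof
            assume "e \<inter> e' = e"
            then have "e \<subseteq> e'"
              by blast
            then have "e = e'"
              using edge[of e] edge[of e'] G 3 by (intro card_subset_eq) (auto intro: card_ge_0_finite)
            then show False
              using 3 by simp
          qed
          then show "e \<inter> e' \<subset> e"
            by blast
        qed
        then have "card (e \<inter> e') \<le> 1"
          using edge[of e] G 3 by auto
        then have "card (p ` (e \<inter> e')) \<le> 1"
          by (metis card_image_le edge G 3(1) card_ge_0_finite finite_Int insertI1 le_trans subsetD zero_less_numeral)
        moreover have "finite (p ` (e \<inter> e'))"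
          by (metis edge G 3(1) card_ge_0_finite finite_Int finite_imageI insertI1 subsetD zero_less_numeral)
        ultimately have "p ` (e \<inter> e') = {} \<or> (\<exists>z. p ` (e \<inter> e') = {z})"
          by (metis card_0_eq card_1_singletonE le_neq_implies_less less_one)
        then show ?thesis
          using img_Int[of e e'] G 3 by auto
      qed
      then have "connected (- (img e \<union> img e'))"
        using G 3 arc by (intro Janiszewski_connected)
          (auto simp: img_compact compact_imp_closed connected_arc_complement)
      then show ?thesis
        using 3 by simp
    qed auto
  qed
  have "open (- (\<Union>e\<in>G. img e))"
    unfolding open_closed double_complement
    using G finite_subset[OF G(1) finE] by (intro closed_UN) (auto simp: img_compact compact_imp_closed)
  then have "connected (- (\<Union>e\<in>G. img e) - p ` V)"
    using con finV by (intro connected_open_delete_finite) simp_all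
  moreover have "- (\<Union>e\<in>G. img e) - p ` V = - skel V G"
    by (auto simp: skel_def)
  ultimately have conG: "connected (- skel V G)"
    by simp
  have fG: "f \<subseteq> - skel V E"
    unfolding f_def by (rule connected_component_subset)
  have "- skel V G \<subseteq> f"
  proof (rule ccontr)
    assume "\<not> - skel V G \<subseteq> f"
    then have "- skel V G - f \<noteq> {}"
      by blast
    moreover have "a \<in> f"
      using a by (simp add: f_def connected_component_refl_eq)
    then have "- skel V G \<inter> f \<noteq> {}"
      using a skel_mono[OF G(1), of V] by auto
    ultimately have "- skel V G \<inter> frontier f \<noteq> {}"
      using connected_Int_frontier[OF conG] by blast
    then show False
      using fr by blast
  qed
  then have sub: "skel V E \<subseteq> skel V G"
    using fG by blast
  have "\<not> E \<subseteq> G"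
  proof
    assume "E \<subseteq> G"
    with G(1) have "G = E"
      by blast
    with G(2) E show False
      by simp
  qed
  then obtain e where e: "e \<in> E" "e \<notin> G"
    by blast
  obtain z where z: "z \<in> img e" "z \<notin> p ` V"
    using interior_point[OF e(1)] by blast
  have "z \<in> skel V G \<inter> img e"
    using sub z e by (auto simp: skel_def)
  then show False
    using img_Int_skel[OF e(1) G(1) e(2)] z edge[OF e(1)] by blast
qed

text \<open>A bridge does not split a face. The old drawing falls into two disjoint compact parts,
  \<open>K1\<close> with the component of \<open>x\<close> and \<open>K2\<close> with the rest. The
  edge meets each of them in a single point, so Janiszewski's theorem can be applied twice, first to
  \<open>K1\<close> and the edge, then to their union and \<open>K2\<close>.\<close>

lemma edge_not_reach_no_split:
  assumes e: "{x, y} \<in> E" "F \<subseteq> E" "{x, y} \<notin> F" "\<not> reach F x y"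
    and con: "connected_component (- skel V F) a b" and ab: "a \<notin> img {x, y}" "b \<notin> img {x, y}"
  shows "connected_component (- (skel V F \<union> img {x, y})) a b"
proof -
  have xy: "x \<in> V" "y \<in> V" "x \<noteq> y"
    using edge[OF e(1)] by auto
  define C where "C = {v\<in>V. reach F x v}"
  define K1 where "K1 = skel C {f\<in>F. f \<subseteq> C}"
  define K2 where "K2 = skel (V - C) {f\<in>F. \<not> f \<subseteq> C}"
  have cl: "f \<subseteq> C \<or> f \<inter> C = {}" if f: "f \<in> F" for f
  proof -
    obtain u v where uv: "f = {u, v}" "u \<in> V" "v \<in> V"
      using edge[of f] f e(2) unfolding card_2_iff by (metis insert_subset subsetD)
    have "reach F x u \<longleftrightarrow> reach F x v"
      using reach_edge[of u v F] reach_trans reach_sym f uv by metis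
    then show ?thesis
      using uv by (auto simp: C_def)
  qed
  have K: "skel V F = K1 \<union> K2"
    by (auto simp: skel_def K1_def K2_def C_def)
  have disj: "K1 \<inter> K2 = {}"
  proof -
    have 1: "p ` C \<inter> p ` (V - C) = {}"
      using inj by (auto simp: C_def inj_on_def)
    have 2: "p ` C \<inter> img f = {}" if "f \<in> F" "\<not> f \<subseteq> C" for f
    proof -
      have "p ` C \<inter> img f \<subseteq> p ` C \<inter> p ` f"
        using verts[of f] that e(2) by (auto simp: C_def)
      also have "\<dots> = p ` (C \<inter> f)"
        using inj_on_image_Int[OF inj, of C f] edge[of f] that e(2) by (auto simp: C_def)
      finally show ?thesis
        using cl[of f] that by auto
    qed
    have 3: "img f \<inter> p ` (V - C) = {}" if "f \<in> F" "f \<subseteq> C" for f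
    proof -
      have "img f \<inter> p ` (V - C) \<subseteq> p ` f \<inter> p ` (V - C)"
        using verts[of f] that e(2) by auto
      also have "\<dots> \<subseteq> p ` C \<inter> p ` (V - C)"
        using that by auto
      finally show ?thesis
        using 1 by auto
    qed
    have 4: "img f \<inter> img g = {}" if "f \<in> F" "f \<subseteq> C" "g \<in> F" "\<not> g \<subseteq> C" for f g
    proof -
      have "f \<inter> g = {}"
        using cl[of g] that by blast
      moreover have "f \<noteq> g"
        using that by blast
      ultimately show ?thesis
        using img_Int[of f g] that e(2) by auto
    qed
    have parts_disjoint: "A \<inter> B = {}" if "A \<in> insert (p ` C) (img ` {f\<in>F. f \<subseteq> C})"
      "B \<in> insert (p ` (V - C)) (img ` {f\<in>F. \<not> f \<subseteq> C})" for A B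
      using that by (elim insertE imageE) (simp_all add: 1 2 3 4)
    have "\<Union>(insert (p ` C) (img ` {f\<in>F. f \<subseteq> C}))
        \<inter> \<Union>(insert (p ` (V - C)) (img ` {f\<in>F. \<not> f \<subseteq> C})) = {}" (is "\<Union>?A \<inter> \<Union>?B = {}")
    proof (rule equals0I, elim IntE UnionE)
      fix z A B assume "A \<in> ?A" "B \<in> ?B" "z \<in> A" "z \<in> B"
      then show False
        using parts_disjoint[of A B] by (metis IntI empty_iff)
    qed
    then show ?thesis
      unfolding K1_def K2_def skel_def Union_insert .
  qed
  have CV: "C \<subseteq> V"
    by (auto simp: C_def)
  have comp: "compact K1" "compact K2"
    unfolding K1_def K2_def using e(2) CV by (auto intro!: skel_compact)
  have xK: "p x \<in> K1"
    using xy by (auto simp: K1_def skel_def C_def)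
  have yK: "p y \<in> K2"
    using xy e(4) by (auto simp: K2_def skel_def C_def)
  have sk: "(K1 \<union> K2) \<inter> img {x, y} = {p x, p y}"
    using img_Int_skel[OF e(1-3)] K by simp
  have "p x \<notin> K2" "p y \<notin> K1"
    using xK yK disj by auto
  moreover have "p x \<in> img {x, y}" "p y \<in> img {x, y}" "K1 \<inter> img {x, y} \<subseteq> {p x, p y}"
    "K2 \<inter> img {x, y} \<subseteq> {p x, p y}"
    using sk by auto
  ultimately have i1: "K1 \<inter> img {x, y} = {p x}" and i2: "(K1 \<union> img {x, y}) \<inter> K2 = {p y}"
    using xK yK disj by auto
  have "connected_component (- K1) a b"
    using con by (rule connected_component_of_subset) (auto simp: K)
  moreover have "connected (- img {x, y})"
    using connected_arc_complement[OF arc[OF e(1)]] by simp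
  ultimately have "connected_component (- (K1 \<union> img {x, y})) a b"
    using comp img_compact[OF e(1)] i1 ab by (intro connected_component_Un_connected_complement) auto
  moreover have "connected_component (- K2) a b"
    using con by (rule connected_component_of_subset) (auto simp: K)
  ultimately have "connected_component (- ((K1 \<union> img {x, y}) \<union> K2)) a b"
    using comp img_compact[OF e(1)] i2 \<open>connected_component (- (K1 \<union> img {x, y})) a b\<close>
    by (intro Janiszewski[OF compact_Un compact_imp_closed]) simp_all
  moreover have "(K1 \<union> img {x, y}) \<union> K2 = skel V F \<union> img {x, y}"
    using K by blast
  ultimately show ?thesis
    by simp
qed

text \<open>All faces bordered by \<open>e\<close> lie in one face of the drawing without \<open>e\<close>. If \<open>e\<close> closes a cycle, that
  face splits into an inner and an outer part only, since the cycle without \<open>e\<close> is connected and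
  Janiszewski's theorem applies.\<close>

lemma edge_borders_at_most_two:
  assumes A: "separated A E" and e: "e \<in> E"
  shows "card {a\<in>A. borders a e} \<le> 2"
proof (rule ccontr)
  assume "\<not> ?thesis"
  then have "3 \<le> card {a\<in>A. borders a e}"
    by simp
  then obtain B where "B \<subseteq> {a\<in>A. borders a e}" "card B = 3"
    using obtain_subset_with_card_n by metis
  then obtain a b c where abc: "{a, b, c} \<subseteq> {a\<in>A. borders a e}" "a \<noteq> b" "b \<noteq> c" "a \<noteq> c"
    by (auto simp: card_3_iff)
  define F where "F = E - {e}"
  have F: "F \<subseteq> E" "e \<notin> F" "insert e F = E"
    using e by (auto simp: F_def)
  have EF: "skel V E = skel V F \<union> img e"
    using skel_insert[of V e F] F by simp
  obtain x y where xy: "e = {x, y}"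
    using edge[OF e] by (auto simp: card_2_iff)
  obtain z0 where z0: "z0 \<in> img e" "z0 \<notin> p ` V"
    using interior_point[OF e] by blast
  have inF: "img e - p ` V \<subseteq> - skel V F"
    using img_Int_skel[OF e F(1,2)] edge[OF e] by blast
  have nskel: "u \<notin> skel V E" if "u \<in> A" for u
    using A that by (auto simp: separated_def)
  have toz0: "connected_component (- skel V F) u z0" if u: "u \<in> A" "borders u e" for u
  proof -
    obtain z where z: "z \<in> closure (connected_component_set (- skel V E) u)" "z \<in> img e" "z \<notin> p ` V"
      using u(2) unfolding borders_def by blast
    have "connected_component (- skel V F) z z0"
      using connected_img_interior[OF e] z z0 inF connected_component_def by blast
    moreover have "connected_component (- skel V F) u z"
    proof -
      have "open (connected_component_set (- skel V F) z)"
        using skel_closed[OF order_refl F(1)] by (intro open_connected_component) auto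
      moreover have "z \<in> connected_component_set (- skel V F) z"
        using z inF by (auto simp: connected_component_refl_eq)
      ultimately obtain w where "connected_component (- skel V F) z w" "connected_component (- skel V E) u w"
        using z(1) closure_iff_nhds_not_empty[of z "connected_component_set (- skel V E) u"] by blast
      moreover have "connected_component (- skel V F) u w"
        using calculation(2) by (rule connected_component_of_subset) (use EF in auto)
      ultimately show ?thesis
        using connected_component_sym connected_component_trans by metis
    qed
    ultimately show ?thesis
      using connected_component_trans by metis
  qed
  have same: "connected_component (- skel V F) u v" if "u \<in> {a, b, c}" "v \<in> {a, b, c}" for u v
    using toz0[of u] toz0[of v] that abc(1) connected_component_sym connected_component_trans by blast
  have sep: "\<not> connected_component (- (skel V F \<union> img e)) u v" if "u \<in> {a, b, c}" "v \<in> {a, b, c}" "u \<noteq> v" for u v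
    using A that abc(1) unfolding separated_def EF by blast
  have out: "u \<notin> skel V F \<union> img e" if "u \<in> {a, b, c}" for u
    using nskel[of u] that abc(1) EF by blast
  show False
  proof (cases "reach F x y")
    case False
    then have "connected_component (- (skel V F \<union> img e)) a b"
      using edge_not_reach_no_split[of x y F a b] same[of a b] out[of a] out[of b] e F xy by auto
    then show False
      using sep[of a b] abc by auto
  next
    case True
    obtain g where g: "simple_path g" "pathfinish g = pathstart g" "img e \<subseteq> path_image g"
      "path_image g \<subseteq> skel V F \<union> img e" "connected (skel V F \<inter> path_image g)"
      using reach_loop[of x y F] True e F xy by metis
    obtain inner outer where io: "connected inner" "connected outer" "inner \<union> outer = - path_image g"
      using Jordan_curve[OF g(1,2)] by metis
    have un: "skel V F \<union> path_image g = skel V F \<union> img e"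
      using g by blast
    have no: False if "connected S" "S \<subseteq> - path_image g" "u \<in> S" "v \<in> S" "u \<in> {a, b, c}" "v \<in> {a, b, c}" "u \<noteq> v" for S u v
    proof -
      have "connected_component (- (skel V F \<union> path_image g)) u v"
        using that skel_compact[OF order_refl F(1)] g same[OF that(5,6)]
        by (intro connected_component_same_side[of _ _ _ _ S])
          (auto simp: closed_simple_path_image)
      then show False
        using sep that un by simp
    qed
    have "u \<in> inner \<or> u \<in> outer" if "u \<in> {a, b, c}" for u
      using out[OF that] g(4) io(3) by blast
    then have "a \<in> inner \<or> a \<in> outer" "b \<in> inner \<or> b \<in> outer" "c \<in> inner \<or> c \<in> outer"
      by simp_all
    \<comment> \<open>Pigeonhole: three points and two sides.\<close>
    then obtain S u v where "connected S" "S \<subseteq> - path_image g" "u \<in> S" "v \<in> S" "u \<in> {a, b, c}" "v \<in> {a, b, c}" "u \<noteq> v"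
      using abc(2-4) io by (metis Un_upper1 Un_upper2 insertI1 insertI2)
    then show False
      using no by blast
  qed
qed

text \<open>Double counting of incidences gives \<open>3 * card A \<le> 2 * card E\<close>, to be
  combined with Euler's inequality. With at most two edges the claim is immediate, as
  \<open>3 * card V\<close> is at least 9.\<close>

lemma card_edges_le:
  assumes V: "3 \<le> card V"
  shows "card E + 6 \<le> 3 * card V"
proof (cases "3 \<le> card E")
  case True
  have "V \<noteq> {}"
    using V by auto
  then obtain A where A: "separated A E" "card E + 2 \<le> card A + card V"
    by (rule many_separated_points)
  have "finite A"
    using A by (simp add: separated_def)
  have "3 * card A = (\<Sum>a\<in>A. 3)"
    by simp
  also have "\<dots> \<le> (\<Sum>a\<in>A. card {e. borders a e})"
  proof (rule sum_mono)
    fix a assume "a \<in> A"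
    then have "a \<notin> skel V E"
      using A(1) unfolding separated_def by blast
    then show "3 \<le> card {e. borders a e}"
      using True by (rule face_borders_three)
  qed
  also have "\<dots> = (\<Sum>a\<in>A. \<Sum>e\<in>E. if borders a e then 1 else 0)"
    using finE by (intro sum.cong refl) (auto simp: sum.If_cases Int_def borders_def)
  also have "\<dots> = (\<Sum>e\<in>E. \<Sum>a\<in>A. if borders a e then 1 else 0)"
    by (rule sum.swap)
  also have "\<dots> = (\<Sum>e\<in>E. card {a\<in>A. borders a e})"
    using \<open>finite A\<close> by (intro sum.cong refl) (auto simp: sum.If_cases Int_def)
  also have "\<dots> \<le> (\<Sum>e\<in>E. 2)"
    using A by (intro sum_mono edge_borders_at_most_two)
  also have "\<dots> = 2 * card E"
    by simp
  finally show ?thesis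
    using A(2) by linarith
qed (use V in linarith)

end

section \<open>The Erdos-Gallai bound for graphs whose cycles have length at most t\<close>

section \<open>Graphs without long cycles\<close>

definition cycle_list :: "('a \<Rightarrow> 'a \<Rightarrow> bool) \<Rightarrow> 'a list \<Rightarrow> bool" where
  "cycle_list R xs \<longleftrightarrow> 3 \<le> length xs \<and> distinct xs \<and> successively R xs \<and> R (last xs) (hd xs)"

text \<open>Relations with an explicit vertex set are used here because the induction deletes and
  merges vertices, and the later reduction from paths to cycles changes the vertex type.\<close>

definition graph_on :: "'a set \<Rightarrow> ('a \<Rightarrow> 'a \<Rightarrow> bool) \<Rightarrow> bool" where
  "graph_on V R \<longleftrightarrow> finite V \<and> (\<forall>x y. R x y \<longrightarrow> x \<in> V \<and> y \<in> V \<and> x \<noteq> y \<and> R y x)"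

lemma graph_onD:
  assumes "graph_on V R"
  shows "finite V" "R x y \<Longrightarrow> x \<in> V" "R x y \<Longrightarrow> y \<in> V" "R x y \<Longrightarrow> x \<noteq> y" "R x y \<Longrightarrow> R y x" "\<not> R x x"
  using assms by (auto simp: graph_on_def)

text \<open>Ordered pairs, so each edge counts twice; this absorbs the denominator 2 of the extremal
  function.\<close>

definition arcs :: "('a \<Rightarrow> 'a \<Rightarrow> bool) \<Rightarrow> ('a \<times> 'a) set" where
  "arcs R = {(x, y). R x y}"

lemma finite_arcs: "graph_on V R \<Longrightarrow> finite (arcs R)"
  by (rule finite_subset[of _ "V \<times> V"]) (auto simp: graph_on_def arcs_def)

lemma cycle_list_rotate1: "cycle_list R xs \<Longrightarrow> cycle_list R (rotate1 xs)"
  by (cases xs; cases "tl xs = []") (auto simp: cycle_list_def successively_append_iff successively_Cons)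

lemma cycle_list_rotate: "cycle_list R xs \<Longrightarrow> cycle_list R (rotate n xs)"
  by (induction n) (auto intro: cycle_list_rotate1)

lemma cycle_list_start:
  assumes "cycle_list R xs" "x \<in> set xs"
  obtains ys where "cycle_list R (x # ys)" "set (x # ys) = set xs" "length (x # ys) = length xs"
proof -
  obtain i where i: "i < length xs" "xs ! i = x"
    using assms by (auto simp: in_set_conv_nth)
  have "hd (rotate i xs) = x"
    using i by (subst hd_rotate_conv_nth) auto
  then have "rotate i xs = x # tl (rotate i xs)"
    using i by (cases "rotate i xs") auto
  then show thesis
    using that[of "tl (rotate i xs)"] cycle_list_rotate[OF assms(1), of i]
    by (metis length_rotate set_rotate)
qed

lemma cycle_list_end:
  assumes "cycle_list R xs" "x \<in> set xs"
  obtains ys where "cycle_list R ys" "last ys = x" "set ys = set xs" "length ys = length xs"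
proof -
  obtain ys where ys: "cycle_list R (x # ys)" "set (x # ys) = set xs" "length (x # ys) = length xs"
    using cycle_list_start[OF assms] by blast
  have "cycle_list R (ys @ [x])"
    using cycle_list_rotate1[OF ys(1)] by simp
  then show thesis
    using that[of "ys @ [x]"] ys by auto
qed

lemma successively_rev_sym:
  assumes "\<And>x y. R x y \<Longrightarrow> R y x" "successively R xs"
  shows "successively R (rev xs)"
  using assms(2) unfolding successively_rev by (rule successively_mono) (use assms(1) in auto)

lemma rtranclp_path:
  assumes "R\<^sup>*\<^sup>* x y"
  obtains xs where "xs \<noteq> []" "distinct xs" "successively R xs" "hd xs = x" "last xs = y"
proof -
  have "\<exists>xs. xs \<noteq> [] \<and> distinct xs \<and> successively R xs \<and> hd xs = x \<and> last xs = y"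
    using assms
  proof (induction rule: rtranclp_induct)
    case base
    show ?case
      by (rule exI[of _ "[x]"]) simp
  next
    case (step y z)
    then obtain xs where xs: "xs \<noteq> []" "distinct xs" "successively R xs" "hd xs = x" "last xs = y"
      by blast
    show ?case
    proof (cases "z \<in> set xs")
      case True
      then obtain as bs where "xs = as @ z # bs"
        by (auto simp: in_set_conv_decomp)
      then show ?thesis
        using xs by (intro exI[of _ "as @ [z]"]) (auto simp: successively_append_iff hd_append split: if_splits)
    next
      case False
      then show ?thesis
        using xs step.hyps by (intro exI[of _ "xs @ [z]"]) (auto simp: successively_append_iff)
    qed
  qed
  then show thesis
    using that by blast
qed

subsection \<open>Contraction of an edge\<close>

definition contract :: "'a \<Rightarrow> 'a \<Rightarrow> ('a \<Rightarrow> 'a \<Rightarrow> bool) \<Rightarrow> 'a \<Rightarrow> 'a \<Rightarrow> bool" where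
  "contract u v R x y \<longleftrightarrow> x \<noteq> v \<and> y \<noteq> v \<and> x \<noteq> y \<and> (R x y \<or> x = u \<and> R v y \<or> y = u \<and> R x v)"

lemma graph_on_contract: "graph_on V R \<Longrightarrow> u \<in> V \<Longrightarrow> graph_on (V - {v}) (contract u v R)"
  unfolding graph_on_def contract_def by blast

text \<open>Each of the two cycle edges at \<open>u\<close> stems from \<open>u\<close> or from
  \<open>v\<close>. If both stem from the same end, that end takes the place of \<open>u\<close>;
  otherwise the edge between \<open>u\<close> and \<open>v\<close> is inserted and the cycle grows
  by one.\<close>

lemma cycle_list_contract:
  assumes R: "graph_on V R" and uv: "R u v" and xs: "cycle_list (contract u v R) xs"
  obtains ys where "cycle_list R ys" "length xs \<le> length ys"
proof -
  have succ: "successively R zs" if "successively (contract u v R) zs" "u \<notin> set zs" for zs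
    using that(1) by (rule successively_mono) (use that(2) in \<open>auto simp: contract_def\<close>)
  have neq_v: "v \<notin> set zs" if "successively (contract u v R) zs" "2 \<le> length zs" for zs
  proof
    assume "v \<in> set zs"
    then obtain as bs where "zs = as @ v # bs"
      by (auto simp: in_set_conv_decomp)
    then show False
      using that by (cases bs; cases as rule: rev_cases) (auto simp: successively_append_iff contract_def successively_Cons)
  qed
  show thesis
  proof (cases "u \<in> set xs")
    case False
    then have "cycle_list R xs"
      using xs succ[of xs] by (cases xs) (auto simp: cycle_list_def contract_def split: if_splits)
    then show thesis
      using that by blast
  next
    case True
    then obtain ps where "cycle_list (contract u v R) (u # ps)" "length (u # ps) = length xs"
      using cycle_list_start[OF xs] by metis
    then have ps: "2 \<le> length ps" "distinct (u # ps)" "successively (contract u v R) (u # ps)"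
      "contract u v R (last ps) u" and len: "length xs = Suc (length ps)"
      by (auto simp: cycle_list_def split: if_splits)
    then have nil: "ps \<noteq> []"
      by auto
    have "v \<notin> set (u # ps)"
      using ps by (intro neq_v) auto
    then have v: "v \<notin> set ps" "v \<noteq> u"
      by auto
    have sp: "successively R ps"
      using ps nil by (intro succ) (auto simp: successively_Cons)
    have "contract u v R u (hd ps)"
      using ps nil by (auto simp: successively_Cons)
    then have a: "R u (hd ps) \<or> R v (hd ps)"
      using graph_onD[OF R] uv by (auto simp: contract_def)
    have b: "R (last ps) u \<or> R (last ps) v"
      using ps(4) graph_onD[OF R] uv by (auto simp: contract_def)
    have vu: "R v u"
      using R uv by (auto simp: graph_on_def)
    consider "R u (hd ps)" "R (last ps) u" | "R v (hd ps)" "R (last ps) v"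
      | "R u (hd ps)" "R (last ps) v" | "R v (hd ps)" "R (last ps) u"
      using a b by blast
    then show thesis
    proof cases
      case 1
      then show thesis
        using that[of "u # ps"] ps nil sp len by (auto simp: cycle_list_def successively_Cons)
    next
      case 2
      then show thesis
        using that[of "v # ps"] ps nil sp len v by (auto simp: cycle_list_def successively_Cons)
    next
      case 3
      then show thesis
        using that[of "u # ps @ [v]"] ps nil sp len v vu
        by (auto simp: cycle_list_def successively_Cons successively_append_iff)
    next
      case 4
      then show thesis
        using that[of "v # ps @ [u]"] ps nil sp len v uv
        by (auto simp: cycle_list_def successively_Cons successively_append_iff)
    qed
  qed
qed

definition common :: "('a \<Rightarrow> 'a \<Rightarrow> bool) \<Rightarrow> 'a \<Rightarrow> 'a \<Rightarrow> 'a set" where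
  "common R u v = {w. R u w \<and> R v w}"

lemma card_arcs_contract:
  assumes R: "graph_on V R" and uv: "R u v"
  shows "card (arcs R) \<le> card (arcs (contract u v R)) + 2 + 2 * card (common R u v)"
proof -
  note g = graph_onD[OF R]
  define A0 where "A0 = {(x, y). R x y \<and> x \<noteq> v \<and> y \<noteq> v}"
  \<comment> \<open>The neighbours of \<open>v\<close> that become new neighbours of
    \<open>u\<close>. The other edges at \<open>v\<close>, namely those to \<open>u\<close> and to
    common neighbours, are the ones that are lost.\<close>
  define D where "D = {y. R v y \<and> y \<noteq> u \<and> \<not> R u y}"
  have fin: "finite (arcs R)" "finite A0" "finite D" "finite (common R u v)"
    using finite_arcs[OF R] g(1)
    by (auto simp: A0_def D_def common_def arcs_def intro: finite_subset[of _ "arcs R"] finite_subset[OF _ g(1)] g)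
  have finN: "finite {y. R v y}"
    by (rule finite_subset[OF _ g(1)]) (auto intro: g)
  have "{y. R v y} \<subseteq> insert u (common R u v \<union> D)"
    by (auto simp: common_def D_def)
  then have "card {y. R v y} \<le> card (insert u (common R u v \<union> D))"
    using fin by (intro card_mono) auto
  also have "\<dots> \<le> Suc (card (common R u v \<union> D))"
    by (rule card_insert_le_m1) auto
  also have "\<dots> \<le> Suc (card (common R u v) + card D)"
    by (simp add: card_Un_le)
  finally have deg: "card {y. R v y} \<le> 1 + card (common R u v) + card D"
    by simp
  have "arcs R \<subseteq> A0 \<union> ({v} \<times> {y. R v y} \<union> {y. R v y} \<times> {v})"
    using g by (auto simp: arcs_def A0_def)
  then have "card (arcs R) \<le> card (A0 \<union> ({v} \<times> {y. R v y} \<union> {y. R v y} \<times> {v}))"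
    using fin finN by (intro card_mono) auto
  also have "\<dots> \<le> card A0 + (card ({v} \<times> {y. R v y}) + card ({y. R v y} \<times> {v}))"
    by (meson add_left_mono card_Un_le le_trans)
  also have "\<dots> = card A0 + 2 * card {y. R v y}"
    by (simp add: card_cartesian_product)
  finally have 1: "card (arcs R) \<le> card A0 + 2 * card {y. R v y}" .
  have sub: "A0 \<union> ({u} \<times> D \<union> D \<times> {u}) \<subseteq> arcs (contract u v R)"
    using g uv by (auto simp: arcs_def A0_def D_def contract_def)
  have "card A0 + (card D + card D) = card (A0 \<union> ({u} \<times> D \<union> D \<times> {u}))"
  proof -
    have "({u} \<times> D) \<inter> (D \<times> {u}) = {}"
      by (auto simp: D_def)
    then have "card ({u} \<times> D \<union> D \<times> {u}) = card D + card D"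
      using fin by (simp add: card_Un_disjoint card_cartesian_product)
    moreover have "A0 \<inter> ({u} \<times> D \<union> D \<times> {u}) = {}"
      using g by (auto simp: A0_def D_def)
    ultimately show ?thesis
      using fin by (simp add: card_Un_disjoint)
  qed
  also have "\<dots> \<le> card (arcs (contract u v R))"
    using sub finite_arcs[OF graph_on_contract[OF R g(2)[OF uv], of v]] by (rule card_mono[rotated])
  finally show ?thesis
    using 1 deg by linarith
qed

subsection \<open>Cut vertices\<close>

definition restrict_rel :: "'a set \<Rightarrow> ('a \<Rightarrow> 'a \<Rightarrow> bool) \<Rightarrow> 'a \<Rightarrow> 'a \<Rightarrow> bool" where
  "restrict_rel A R x y \<longleftrightarrow> R x y \<and> x \<in> A \<and> y \<in> A"

lemma graph_on_restrict: "graph_on V R \<Longrightarrow> A \<subseteq> V \<Longrightarrow> graph_on A (restrict_rel A R)"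
  by (auto simp: graph_on_def restrict_rel_def intro: finite_subset)

lemma cycle_list_restrict: "cycle_list (restrict_rel A R) xs \<Longrightarrow> cycle_list R xs"
  by (auto simp: cycle_list_def restrict_rel_def intro: successively_mono)

text \<open>An empty intersection is a disconnection, a single common vertex a cut vertex; absence
  of separations plays the role of 2-connectedness.\<close>

definition separation :: "'a set \<Rightarrow> ('a \<Rightarrow> 'a \<Rightarrow> bool) \<Rightarrow> 'a set \<Rightarrow> 'a set \<Rightarrow> bool" where
  "separation V R A B \<longleftrightarrow> A \<union> B = V \<and> A \<noteq> V \<and> B \<noteq> V \<and> card (A \<inter> B) \<le> 1
     \<and> (\<forall>x y. R x y \<longrightarrow> x \<in> A \<and> y \<in> A \<or> x \<in> B \<and> y \<in> B)"

lemma card_arcs_separation: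
  assumes R: "graph_on V R" and AB: "separation V R A B"
  shows "card (arcs R) \<le> card (arcs (restrict_rel A R)) + card (arcs (restrict_rel B R))"
proof -
  have "arcs R \<subseteq> arcs (restrict_rel A R) \<union> arcs (restrict_rel B R)"
    using AB by (auto simp: arcs_def restrict_rel_def separation_def)
  moreover have "finite (arcs (restrict_rel A R))" "finite (arcs (restrict_rel B R))"
    using graph_on_restrict[OF R] finite_arcs AB unfolding separation_def by (metis Un_upper1, metis Un_upper2)
  ultimately have "card (arcs R) \<le> card (arcs (restrict_rel A R) \<union> arcs (restrict_rel B R))"
    by (intro card_mono) auto
  also have "\<dots> \<le> card (arcs (restrict_rel A R)) + card (arcs (restrict_rel B R))"
    by (rule card_Un_le)
  finally show ?thesis .
qed


subsection \<open>Ears of a longest cycle\<close>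

definition outer_path :: "('a \<Rightarrow> 'a \<Rightarrow> bool) \<Rightarrow> 'a list \<Rightarrow> 'a list \<Rightarrow> bool" where
  "outer_path R xs zs \<longleftrightarrow> zs \<noteq> [] \<and> distinct zs \<and> set zs \<inter> set xs = {} \<and> successively R zs"

text \<open>\<open>zs\<close> lists the inner vertices only. The ear leaves the cycle at its last
  vertex, which is no restriction up to rotation, and \<open>Suc j < length xs\<close> makes it
  return at a different one.\<close>

definition ear :: "('a \<Rightarrow> 'a \<Rightarrow> bool) \<Rightarrow> 'a list \<Rightarrow> 'a list \<Rightarrow> nat \<Rightarrow> bool" where
  "ear R xs zs j \<longleftrightarrow> cycle_list R xs \<and> outer_path R xs zs \<and> R (last xs) (hd zs)
     \<and> Suc j < length xs \<and> R (last zs) (xs ! j)"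

lemma outer_path_rev:
  assumes "graph_on V R" "outer_path R xs zs"
  shows "outer_path R xs (rev zs)"
  using assms(2) successively_rev_sym[of R zs] graph_onD(5)[OF assms(1)] unfolding outer_path_def by simp

lemma last_take_Suc: "j < length xs \<Longrightarrow> last (take (Suc j) xs) = xs ! j"
  by (simp add: take_Suc_conv_app_nth)

lemma hd_eq_nth_0: "0 < length xs \<Longrightarrow> hd xs = xs ! 0"
  by (cases xs) auto

lemma successively_take: "successively R xs \<Longrightarrow> successively R (take n xs)"
  by (metis append_take_drop_id successively_append_iff)

lemma successively_drop: "successively R xs \<Longrightarrow> successively R (drop n xs)"
  by (metis append_take_drop_id successively_append_iff)

text \<open>The new cycle runs through the ear to \<open>xs ! j\<close>, backwards to
  \<open>xs ! 0\<close>, along the chord to \<open>xs ! (j + m)\<close> and forwards to the last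
  vertex, where the ear starts. Only the \<open>m - 1\<close> vertices strictly between
  \<open>xs ! j\<close> and \<open>xs ! (j + m)\<close> are lost.\<close>

lemma longer_cycle_crossing:
  assumes R: "graph_on V R" and ear: "ear R xs zs j"
    and m: "1 \<le> m" "j + m < length xs" "R (xs ! 0) (xs ! (j + m))"
  obtains ys where "cycle_list R ys" "length ys + m = length xs + length zs + 1"
proof -
  define as bs where "as = take (Suc j) xs" and "bs = drop (j + m) xs"
  note e = ear[unfolded ear_def outer_path_def cycle_list_def]
  have as: "as \<noteq> []" "last as = xs ! j" "hd as = xs ! 0" "length as = Suc j"
  proof -
    have "hd xs = xs ! 0"
      using e by (intro hd_eq_nth_0) auto
    then show "as \<noteq> []" "last as = xs ! j" "hd as = xs ! 0" "length as = Suc j"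
      using e last_take_Suc[of j xs] by (auto simp: as_def)
  qed
  have bs: "bs \<noteq> []" "last bs = last xs" "hd bs = xs ! (j + m)" "length bs = length xs - (j + m)"
    using m by (auto simp: bs_def hd_drop_conv_nth)
  have "set as \<inter> set bs = {}"
    unfolding as_def bs_def using e m by (intro set_take_disj_set_drop_if_distinct) auto
  then have "distinct (zs @ rev as @ bs)"
    using e unfolding as_def bs_def by (auto dest: in_set_takeD in_set_dropD)
  moreover have "successively R (zs @ rev as @ bs)"
    using e m as bs graph_onD[OF R] successively_rev_sym[of R as]
    by (auto simp: successively_append_iff hd_rev last_rev as_def bs_def successively_take successively_drop)
  moreover have "1 \<le> length zs"
    using e by (cases zs) auto
  ultimately have "cycle_list R (zs @ rev as @ bs)"
    using e as bs m by (auto simp: cycle_list_def hd_append)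
  then show thesis
    using that[of "zs @ rev as @ bs"] as bs m by simp
qed

text \<open>\<open>zs\<close> replaces the \<open>i - j - 1\<close> vertices strictly between
  \<open>xs ! j\<close> and \<open>xs ! i\<close>. The assumption \<open>long\<close> ensures that
  at least three vertices result.\<close>

lemma longer_cycle_replace:
  assumes xs: "cycle_list R xs" "outer_path R xs zs"
    and ij: "j < i" "i < length xs" "R (xs ! j) (hd zs)" "R (last zs) (xs ! i)"
    and long: "2 \<le> length zs + j + length xs - i"
  obtains ys where "cycle_list R ys" "length ys + i = length xs + length zs + j + 1"
proof -
  define as bs where "as = take (Suc j) xs" and "bs = drop i xs"
  note e = xs[unfolded outer_path_def cycle_list_def]
  have as: "as \<noteq> []" "last as = xs ! j" "hd as = hd xs" "length as = Suc j"
    using e ij last_take_Suc[of j xs] by (auto simp: as_def)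
  have bs: "bs \<noteq> []" "last bs = last xs" "hd bs = xs ! i" "length bs = length xs - i"
    using ij by (auto simp: bs_def hd_drop_conv_nth)
  have "set as \<inter> set bs = {}"
    unfolding as_def bs_def using e ij by (intro set_take_disj_set_drop_if_distinct) auto
  then have "distinct (as @ zs @ bs)"
    using e unfolding as_def bs_def by (auto dest: in_set_takeD in_set_dropD)
  moreover have "successively R (as @ zs @ bs)"
    using e ij as bs
    by (auto simp: successively_append_iff as_def bs_def successively_take successively_drop)
  ultimately have "cycle_list R (as @ zs @ bs)"
    using e as bs ij long by (auto simp: cycle_list_def hd_append)
  then show thesis
    using that[of "as @ zs @ bs"] as bs ij by simp
qed

text \<open>Let \<open>y\<close> be the last vertex of the cycle, \<open>y1\<close> its successor on the cycle and \<open>z1\<close> the first vertex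
  of the ear. If \<open>y1\<close> were adjacent to the successor of a neighbour of \<open>z1\<close>, or to one of the
  \<open>length zs\<close> vertices that follow \<open>xs ! j\<close>, then the cycle could be rerouted through the ear and
  become longer. So the neighbours of \<open>y1\<close> and these positions occupy disjoint parts of the cycle,
  each of size more than \<open>c\<close>.\<close>

lemma card_common_neighbours_ear:
  assumes R: "graph_on V R" and ear: "ear R xs zs j"
    and longest: "\<And>ys. cycle_list R ys \<Longrightarrow> length ys \<le> length xs"
    and longest_ear: "\<And>zs'. ear R xs zs' j \<Longrightarrow> length zs' \<le> length zs"
    and c: "\<And>x y. R x y \<Longrightarrow> c \<le> card (common R x y)"
  shows "2 * c + 2 \<le> length xs"
proof -
  note e = ear[unfolded ear_def outer_path_def cycle_list_def]
  note g = graph_onD[OF R]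
  define L where "L = length xs"
  define q where "q = length zs"
  define y where "y = last xs"
  define y1 where "y1 = xs ! 0"
  define z1 where "z1 = hd zs"
  have L: "3 \<le> L" and j: "Suc j < L"
    using e by (auto simp: L_def)
  have yL: "y = xs ! (L - 1)"
    unfolding y_def L_def using L by (intro last_conv_nth) (auto simp: L_def)
  have q: "1 \<le> q"
    using e by (cases zs) (auto simp: q_def)
  have hd: "hd xs = y1"
    unfolding y1_def using L by (intro hd_eq_nth_0) (auto simp: L_def)
  have y1: "R y y1"
    using e hd by (simp add: y_def)
  have yz: "R y z1"
    using e by (simp add: y_def z1_def)
  have z1: "z1 \<in> set zs" "z1 \<notin> set xs"
  proof -
    show "z1 \<in> set zs"
      using e by (simp add: z1_def)
    then show "z1 \<notin> set xs"
      using e by blast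
  qed
  have nth_in: "xs ! i \<in> set xs" if "i < L" for i
    using that by (simp add: L_def)
  have nth_eq: "xs ! i = xs ! i' \<longleftrightarrow> i = i'" if "i < L" "i' < L" for i i'
    using that e by (simp add: L_def nth_eq_iff_index_eq)
  define N where "N = {i. i < L \<and> R y1 (xs ! i)}"
  define Z where "Z = {i. Suc i < L \<and> i \<noteq> j \<and> R z1 (xs ! i)}"
  have fin: "finite N" "finite Z"
    by (auto simp: N_def Z_def intro: finite_subset[of _ "{..<L}"])
  \<comment> \<open>The reversed ear could replace the vertices between \<open>xs ! j\<close> and
    the end of the cycle, so a longest cycle has at least \<open>q\<close> of them.\<close>
  have end_gap: "j + q + 2 \<le> L"
  proof -
    obtain ys where "cycle_list R ys" "length ys + (L - 1) = L + length (rev zs) + j + 1"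
    proof (rule longer_cycle_replace[of R xs "rev zs" j "L - 1"])
      show "cycle_list R xs" "outer_path R xs (rev zs)"
        using ear outer_path_rev[OF R] by (auto simp: ear_def)
      show "R (xs ! j) (hd (rev zs))"
        using e g(5) by (simp add: hd_rev)
      show "R (last (rev zs)) (xs ! (L - 1))"
        unfolding yL[symmetric] using g(5)[OF yz] e by (simp add: last_rev z1_def)
      show "j < L - 1" "L - 1 < length xs" "2 \<le> length (rev zs) + j + length xs - (L - 1)"
        using j q L by (auto simp: L_def q_def)
    qed (simp add: L_def)
    with longest[of ys] show ?thesis
      using L by (simp add: L_def q_def)
  qed
  \<comment> \<open>The same rerouting, now entering the cycle from \<open>z1\<close> at
    \<open>xs ! i\<close>. It keeps the successors of \<open>Z\<close> clear of the block of
    \<open>q\<close> positions after \<open>j\<close>.\<close>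
  have gap: "j + q < i" if i: "i \<in> Z" "j < i" for i
  proof -
    have "i < L" "R z1 (xs ! i)"
      using that by (auto simp: Z_def)
    obtain ys where "cycle_list R ys" "length ys + i = L + length (rev zs) + j + 1"
    proof (rule longer_cycle_replace[of R xs "rev zs" j i])
      show "cycle_list R xs" "outer_path R xs (rev zs)"
        using ear outer_path_rev[OF R] by (auto simp: ear_def)
      show "R (xs ! j) (hd (rev zs))"
        using e g(5) by (simp add: hd_rev)
      show "R (last (rev zs)) (xs ! i)"
        using \<open>R z1 (xs ! i)\<close> e by (simp add: last_rev z1_def)
      show "j < i" "i < length xs" "2 \<le> length (rev zs) + j + length xs - i"
        using i q \<open>i < L\<close> by (auto simp: L_def q_def)
    qed (simp add: L_def)
    with longest[of ys] show ?thesis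
      by (simp add: L_def q_def)
  qed
  \<comment> \<open>\<open>z1\<close> alone is an ear that ends at \<open>xs ! i\<close>. The chord
    to the next position skips no vertex, so the cycle would gain \<open>z1\<close>.\<close>
  have excluded1: "Suc i \<notin> N" if "i \<in> Z" for i
  proof
    assume "Suc i \<in> N"
    then have "Suc i < L" "R (xs ! 0) (xs ! (i + 1))"
      by (auto simp: N_def y1_def)
    moreover have "ear R xs [z1] i"
      using that e z1 by (auto simp: ear_def outer_path_def Z_def L_def z1_def cycle_list_def)
    ultimately obtain ys where "cycle_list R ys" "length ys + 1 = L + length [z1] + 1"
      using longer_cycle_crossing[OF R, of xs "[z1]" i 1] by (auto simp: L_def)
    with longest[of ys] show False
      by (simp add: L_def)
  qed
  have excluded2: "j + m \<notin> N" if m: "1 \<le> m" "m \<le> q" for m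
  proof
    assume "j + m \<in> N"
    then have "j + m < L" "R (xs ! 0) (xs ! (j + m))"
      by (auto simp: N_def y1_def)
    then obtain ys where "cycle_list R ys" "length ys + m = L + q + 1"
      using longer_cycle_crossing[OF R ear m(1)] by (auto simp: L_def q_def)
    with longest[of ys] that show False
      by (simp add: L_def)
  qed
  have excluded0: "0 \<notin> N"
    using g by (simp add: N_def y1_def)
  \<comment> \<open>A common neighbour of \<open>y\<close> and \<open>y1\<close> off the cycle could
    be inserted between them. The extra 1 is \<open>y\<close> itself.\<close>
  have cardN: "c + 1 \<le> card N"
  proof -
    have "insert y (common R y y1) \<subseteq> (!) xs ` N"
    proof
      fix w assume w: "w \<in> insert y (common R y y1)"
      have "w \<in> set xs"
      proof (rule ccontr)
        assume nw: "w \<notin> set xs"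
        have "y \<in> set xs"
          unfolding yL using L by (intro nth_in) simp
        then have "R y w" "R w y1"
          using w nw g(5) by (auto simp: common_def)
        then have "cycle_list R (xs @ [w])"
          using nw e hd by (cases "xs = []") (auto simp: cycle_list_def successively_append_iff y_def)
        from longest[OF this] show False
          by simp
      qed
      then obtain i where "i < L" "w = xs ! i"
        by (auto simp: in_set_conv_nth L_def)
      moreover have "R y1 w"
        using w g y1 by (auto simp: common_def)
      ultimately show "w \<in> (!) xs ` N"
        by (auto simp: N_def)
    qed
    then have "card (insert y (common R y y1)) \<le> card ((!) xs ` N)"
      using fin by (intro card_mono) auto
    also have "\<dots> \<le> card N"
      using fin by (intro card_image_le)
    finally have "card (insert y (common R y y1)) \<le> card N" .
    moreover have "y \<notin> common R y y1"
      using g by (auto simp: common_def)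
    moreover have "finite (common R y y1)"
      by (rule finite_subset[OF _ g(1)]) (auto simp: common_def intro: g)
    ultimately show ?thesis
      using c[OF y1] by simp
  qed
  \<comment> \<open>A common neighbour of \<open>y\<close> and \<open>z1\<close> off both cycle and
    ear would prolong the ear. Those on the ear number at most \<open>q - 1\<close>, since
    \<open>z1\<close> is not its own neighbour, and position \<open>j\<close>, left out of
    \<open>Z\<close> because its successor opens the block, accounts for one more.\<close>
  have cardZ: "c \<le> card Z + q"
  proof -
    have "common R y z1 \<subseteq> (!) xs ` insert j Z \<union> (set zs - {z1})"
    proof
      fix w assume w: "w \<in> common R y z1"
      then have wR: "R y w" "R z1 w" "w \<noteq> y" "w \<noteq> z1"
        using g by (auto simp: common_def)
      show "w \<in> (!) xs ` insert j Z \<union> (set zs - {z1})"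
      proof (cases "w \<in> set xs")
        case True
        then obtain i where i: "i < L" "w = xs ! i"
          by (auto simp: in_set_conv_nth L_def)
        with wR yL have "Suc i < L"
          by (cases "i = L - 1") auto
        with i wR have "i \<in> insert j Z"
          by (auto simp: Z_def)
        with i show ?thesis
          by blast
      next
        case False
        have "w \<in> set zs"
        proof (rule ccontr)
          assume "w \<notin> set zs"
          then have "ear R xs (w # zs) j"
            using e wR g False by (auto simp: ear_def outer_path_def cycle_list_def successively_Cons y_def z1_def)
          from longest_ear[OF this] show False
            by simp
        qed
        with wR show ?thesis
          by blast
      qed
    qed
    then have "card (common R y z1) \<le> card ((!) xs ` insert j Z \<union> (set zs - {z1}))"
      using fin by (intro card_mono) auto
    also have "\<dots> \<le> card ((!) xs ` insert j Z) + card (set zs - {z1})"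
      by (rule card_Un_le)
    also have "\<dots> \<le> card (insert j Z) + (q - 1)"
      using fin e z1 by (intro add_mono card_image_le) (auto simp: distinct_card q_def)
    also have "\<dots> \<le> Suc (card Z) + (q - 1)"
      using fin by (simp add: card_insert_if)
    finally show ?thesis
      using c[OF yz] q by simp
  qed
  define X where "X = insert 0 (Suc ` Z \<union> {j + 1..j + q})"
  have "N \<inter> X = {}"
  proof -
    have "i \<notin> N" if "i \<in> {j + 1..j + q}" for i
    proof -
      have "1 \<le> i - j" "i - j \<le> q" "j + (i - j) = i"
        using that by auto
      then show ?thesis
        using excluded2 by metis
    qed
    then show ?thesis
      using excluded0 excluded1 by (auto simp: X_def)
  qed
  moreover have NX: "N \<union> X \<subseteq> {..<L}"
    using end_gap L by (auto simp: N_def X_def Z_def)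
  moreover have "card X = 1 + card Z + q"
  proof -
    have "Suc i \<notin> {j + 1..j + q}" if "i \<in> Z" for i
      using gap[OF that] that by (cases "j < i") (auto simp: Z_def)
    then have "Suc ` Z \<inter> {j + 1..j + q} = {}"
      by blast
    then have "card (Suc ` Z \<union> {j + 1..j + q}) = card Z + q"
      using fin by (simp add: card_Un_disjoint card_image)
    moreover have "0 \<notin> Suc ` Z \<union> {j + 1..j + q}"
      by auto
    ultimately show ?thesis
      using fin by (simp add: X_def)
  qed
  moreover have "finite X"
    using fin by (simp add: X_def)
  ultimately have "card N + card X \<le> card {..<L}"
    using fin card_mono[OF _ NX] by (subst card_Un_disjoint[symmetric]) auto
  then show ?thesis
    using cardN cardZ \<open>card X = 1 + card Z + q\<close> by (simp add: L_def)
qed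

text \<open>\<open>D\<close> is the component of a vertex off the cycle after the cycle is deleted,
  and \<open>T\<close> the set of its attachments on the cycle. With at most one attachment,
  \<open>D \<union> T\<close> and \<open>V - D\<close> form a separation; two attachments are joined
  by a path inside \<open>D\<close>, and the cycle is rotated to end at one of them.\<close>

lemma separation_or_ear:
  assumes R: "graph_on V R" and xs: "cycle_list R xs" and V: "\<not> V \<subseteq> set xs"
    and nosep: "\<And>A B. \<not> separation V R A B"
  obtains ys zs j where "ear R ys zs j" "length ys = length xs"
proof -
  note g = graph_onD[OF R]
  have xsV: "set xs \<subseteq> V"
  proof
    fix x assume "x \<in> set xs"
    then obtain ys where "cycle_list R (x # ys)"
      using cycle_list_start[OF xs] by blast
    then show "x \<in> V"
      using g by (cases ys) (auto simp: cycle_list_def)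
  qed
  obtain z where z: "z \<in> V" "z \<notin> set xs"
    using V by blast
  define R' where "R' x y \<longleftrightarrow> R x y \<and> x \<notin> set xs \<and> y \<notin> set xs" for x y
  define D where "D = {d. R'\<^sup>*\<^sup>* z d}"
  have D: "D \<subseteq> V - set xs"
  proof
    fix d assume "d \<in> D"
    then have "R'\<^sup>*\<^sup>* z d"
      by (simp add: D_def)
    then show "d \<in> V - set xs"
      by (induction rule: rtranclp_induct) (use z g in \<open>auto simp: R'_def\<close>)
  qed
  have zD: "z \<in> D"
    by (simp add: D_def)
  define T where "T = {x\<in>set xs. \<exists>d\<in>D. R x d}"
  have step: "y \<in> D \<or> y \<in> T" if "d \<in> D" "R d y" for d y
  proof (cases "y \<in> set xs")
    case True
    then show ?thesis
      using that g(5)[OF that(2)] unfolding T_def by blast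
  next
    case False
    then have "R' d y"
      using that D by (auto simp: R'_def)
    then show ?thesis
      using that by (auto simp: D_def)
  qed
  have "\<not> card T \<le> 1"
  proof
    assume T: "card T \<le> 1"
    have "T \<subseteq> V" "D \<inter> T = {}"
      using xsV D by (auto simp: T_def)
    have "separation V R (D \<union> T) (V - D)"
      unfolding separation_def
    proof (intro conjI allI impI)
      show "D \<union> T \<union> (V - D) = V"
        using D \<open>T \<subseteq> V\<close> by blast
      have "card (set xs) = length xs"
        using xs by (simp add: cycle_list_def distinct_card)
      then have "\<not> set xs \<subseteq> T"
        using T xs card_mono[of T "set xs"] by (auto simp: cycle_list_def T_def)
      then show "D \<union> T \<noteq> V"
        using xsV D by blast
      show "V - D \<noteq> V"
        using zD z by blast
      have "(D \<union> T) \<inter> (V - D) = T"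
        using \<open>T \<subseteq> V\<close> \<open>D \<inter> T = {}\<close> by blast
      then show "card ((D \<union> T) \<inter> (V - D)) \<le> 1"
        using T by simp
    next
      fix x y assume "R x y"
      then show "x \<in> D \<union> T \<and> y \<in> D \<union> T \<or> x \<in> V - D \<and> y \<in> V - D"
        using step[of x y] step[of y x] g by blast
    qed
    then show False
      using nosep by blast
  qed
  then have "\<not> (\<forall>a\<in>T. \<forall>b\<in>T. a = b)"
    using card_le_Suc0_iff_eq[of T] by (simp add: T_def)
  then obtain a b where ab: "a \<in> T" "b \<in> T" "a \<noteq> b"
    by blast
  then obtain d d' where d: "d \<in> D" "R a d" "d' \<in> D" "R b d'"
    by (auto simp: T_def)
  have symR': "R'\<^sup>*\<^sup>* v u" if "R'\<^sup>*\<^sup>* u v" for u v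
    using that by (rule sympD[OF symp_rtranclp, rotated]) (use g in \<open>auto simp: symp_def R'_def\<close>)
  have "R'\<^sup>*\<^sup>* d d'"
    using d symR'[of z d] by (auto simp: D_def)
  then obtain zs where zs: "zs \<noteq> []" "distinct zs" "successively R' zs" "hd zs = d" "last zs = d'"
    by (rule rtranclp_path)
  have disj: "set zs \<inter> set xs = {}"
  proof (cases "2 \<le> length zs")
    case True
    have "x \<notin> set xs" if "x \<in> set zs" for x
    proof -
      obtain as bs where "zs = as @ x # bs"
        using \<open>x \<in> set zs\<close> by (auto simp: in_set_conv_decomp)
      then show ?thesis
        using zs(3) True by (cases bs; cases as rule: rev_cases)
          (auto simp: successively_append_iff R'_def successively_Cons)
    qed
    then show ?thesis
      by blast
  next
    case False
    then have "zs = [d]"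
      using zs by (cases zs; cases "tl zs") auto
    then show ?thesis
      using d D by auto
  qed
  obtain ys where ys: "cycle_list R ys" "last ys = a" "set ys = set xs" "length ys = length xs"
    using cycle_list_end[OF xs, of a] ab by (auto simp: T_def)
  have "b \<in> set ys"
    using ab ys by (simp add: T_def)
  then obtain j where j: "j < length ys" "ys ! j = b"
    by (auto simp: in_set_conv_nth)
  moreover have "j \<noteq> length ys - 1"
    using j ys ab by (metis last_conv_nth list.size(3) not_less_zero)
  moreover have "successively R zs"
    using zs(3) by (rule successively_mono) (auto simp: R'_def)
  ultimately have "ear R ys zs j"
    using ys zs d disj g by (auto simp: ear_def outer_path_def)
  then show thesis
    using that ys by blast
qed

subsection \<open>The bound of Erdos and Gallai\<close>

text \<open>Contracting an edge with \<open>c\<close> common neighbours destroys \<open>c + 1\<close> edges and creates no longer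
  cycle, so one may assume that the ends of every edge have many common neighbours.\<close>

theorem card_arcs_no_long_cycle:
  assumes "graph_on V R" "V \<noteq> {}" "2 \<le> t" "\<And>xs. cycle_list R xs \<Longrightarrow> length xs \<le> t"
  shows "card (arcs R) \<le> t * (card V - 1)"
  using assms
proof (induction "card V" arbitrary: V R rule: less_induct)
  case less
  note R = less.prems(1) and t = less.prems(3) and short = less.prems(4)
  note g = graph_onD[OF R]
  have V: "0 < card V"
    using less.prems g by (simp add: card_gt_0_iff)
  consider A B where "separation V R A B"
    | u v where "R u v" "2 + 2 * card (common R u v) \<le> t"
    | "\<And>A B. \<not> separation V R A B" "\<And>u v. R u v \<Longrightarrow> t < 2 + 2 * card (common R u v)"
    by (meson not_le)
  then show ?case
  proof cases
    case 1
    then have AB: "A \<union> B = V" "A \<noteq> V" "B \<noteq> V" "card (A \<inter> B) \<le> 1"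
      by (auto simp: separation_def)
    then have ne: "A \<noteq> {}" "B \<noteq> {}" and fin: "finite A" "finite B"
      using g(1) by auto
    have lt: "card A < card V" "card B < card V"
      using AB g(1) by (auto intro!: psubset_card_mono)
    have "card A + card B = card V + card (A \<inter> B)"
      using card_Un_Int[OF fin] AB by simp
    moreover have "0 < card A" "0 < card B"
      using ne fin by (simp_all add: card_gt_0_iff)
    ultimately have le: "(card A - 1) + (card B - 1) \<le> card V - 1"
      using AB by linarith
    have "card (arcs (restrict_rel A R)) \<le> t * (card A - 1)"
      using AB ne t short by (intro less.hyps[OF lt(1)] graph_on_restrict[OF R]) (auto dest: cycle_list_restrict)
    moreover have "card (arcs (restrict_rel B R)) \<le> t * (card B - 1)"
      using AB ne t short by (intro less.hyps[OF lt(2)] graph_on_restrict[OF R]) (auto dest: cycle_list_restrict)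
    ultimately have "card (arcs R) \<le> t * ((card A - 1) + (card B - 1))"
      using card_arcs_separation[OF R 1] by (simp add: distrib_left)
    also have "\<dots> \<le> t * (card V - 1)"
      using le by (rule mult_left_mono) simp
    finally show ?thesis .
  next
    case 2
    have uv: "u \<in> V" "v \<in> V" "u \<noteq> v"
      using g 2 by auto
    have card: "card (V - {v}) = card V - 1"
      using uv g by simp
    have "card (arcs (contract u v R)) \<le> t * (card (V - {v}) - 1)"
    proof (rule less.hyps)
      show "card (V - {v}) < card V"
        using V card by simp
      show "graph_on (V - {v}) (contract u v R)"
        using graph_on_contract[OF R] uv by simp
      show "V - {v} \<noteq> {}"
        using uv by blast
      show "length xs \<le> t" if "cycle_list (contract u v R) xs" for xs
        using cycle_list_contract[OF R 2(1) that] short le_trans by metis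
    qed (rule t)
    moreover have "1 \<le> card V - 1"
      using uv card g(1) by (metis DiffI Suc_leI One_nat_def card_gt_0_iff empty_iff finite_Diff singletonD)
    ultimately have "card (arcs R) \<le> t * (card V - 1 - 1) + t"
      using card_arcs_contract[OF R 2(1)] 2(2) card by simp
    also have "\<dots> = t * (card V - 1)"
    proof -
      have "card V - 1 = Suc (card V - 1 - 1)"
        using \<open>1 \<le> card V - 1\<close> by simp
      then show ?thesis
        by (metis add.commute mult_Suc_right)
    qed
    finally show ?thesis .
  next
    case 3
    show ?thesis
    proof (cases "arcs R = {}")
      case False
      then obtain u v where uv: "R u v"
        by (auto simp: arcs_def)
      have "0 < card (common R u v)"
        using 3(2)[OF uv] t by linarith
      then obtain w where "w \<in> common R u v"
        by (metis card.empty equals0I less_irrefl)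
      then have "cycle_list R [u, v, w]"
        using uv g by (auto simp: cycle_list_def common_def)
      moreover have "\<forall>xs. cycle_list R xs \<longrightarrow> length xs \<le> t"
        using short by blast
      ultimately obtain xs where xs: "cycle_list R xs" and longest: "\<And>ys. cycle_list R ys \<Longrightarrow> length ys \<le> length xs"
        using ex_has_greatest_nat[of "cycle_list R" "[u, v, w]" length "Suc t"] by (metis le_imp_less_Suc)
      \<comment> \<open>Once the longest cycle passes through every vertex,
        \<open>card V \<le> t\<close> and counting all ordered pairs suffices.\<close>
      have "V \<subseteq> set xs"
      proof (rule ccontr)
        assume "\<not> V \<subseteq> set xs"
        then obtain ys zs j where ear: "ear R ys zs j" "length ys = length xs"
          using separation_or_ear[OF R xs _ 3(1)] by blast
        have "length zs' < Suc (card V)" if "ear R ys zs' j" for zs'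
        proof -
          have zs': "zs' \<noteq> []" "distinct zs'" "successively R zs'" "R (last ys) (hd zs')"
            using that by (auto simp: ear_def outer_path_def)
          have "set zs' \<subseteq> V"
          proof
            fix x assume "x \<in> set zs'"
            then obtain as bs where "zs' = as @ x # bs"
              by (auto simp: in_set_conv_decomp)
            then show "x \<in> V"
              using zs' g by (cases as rule: rev_cases) (auto simp: successively_append_iff)
          qed
          then have "card (set zs') \<le> card V"
            using g(1) by (rule card_mono[rotated])
          then show ?thesis
            using zs' by (simp add: distinct_card)
        qed
        then obtain zs' where zs': "ear R ys zs' j" "\<And>zs''. ear R ys zs'' j \<Longrightarrow> length zs'' \<le> length zs'"
          using ex_has_greatest_nat[of "\<lambda>zs. ear R ys zs j" zs length "Suc (card V)"] ear by blast
        \<comment> \<open>\<open>t < 2 + 2 * card (common R x y)\<close> means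
          \<open>t div 2 \<le> card (common R x y)\<close>, and \<open>2 * (t div 2) + 2\<close>
          exceeds \<open>t\<close> whatever its parity.\<close>
        define c where "c = t div 2"
        have "c \<le> card (common R x y)" if "R x y" for x y
          using 3(2)[OF that] unfolding c_def by linarith
        then have "2 * c + 2 \<le> length ys"
          using zs' longest ear(2) by (intro card_common_neighbours_ear[OF R]) auto
        moreover have "length ys \<le> t"
          using short[OF xs] ear by simp
        ultimately show False
          unfolding c_def by linarith
      qed
      then have "card V \<le> card (set xs)"
        by (intro card_mono) auto
      also have "\<dots> \<le> t"
        using card_length[of xs] short[OF xs] by linarith
      finally have le: "card V \<le> t" .
      have "arcs R \<subseteq> Sigma V (\<lambda>x. V - {x})"
        using g by (auto simp: arcs_def)
      then have "card (arcs R) \<le> card (Sigma V (\<lambda>x. V - {x}))"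
        using g(1) by (intro card_mono) auto
      also have "\<dots> = card V * (card V - 1)"
        using g(1) by (simp add: card_SigmaI)
      also have "\<dots> \<le> t * (card V - 1)"
        using le by (rule mult_right_mono) simp
      finally show ?thesis .
    qed simp
  qed
qed

section \<open>The number of edges inside a vertex set for each graph class\<close>

section \<open>Extremal bounds\<close>

lemma graph_on_adj_subset: "simple_graph F \<Longrightarrow> (\<And>e. e \<in> F \<Longrightarrow> e \<subseteq> U) \<Longrightarrow> graph_on U (adj F)"
  for F :: "'v::finite set set"
  using adj_irrefl[of F] adj_commute[of F] by (auto simp: graph_on_def adj_def)

lemma card_arcs_adj:
  assumes "simple_graph F"
  shows "card (arcs (adj F)) = 2 * card F"
proof -
  have "arcs (adj F) = Sigma UNIV (\<lambda>u. {v. adj F u v})"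
    by (auto simp: arcs_def)
  then have "card (arcs (adj F)) = (\<Sum>u\<in>UNIV. card {v. adj F u v})"
    by (simp add: card_SigmaI)
  then show ?thesis
    using degree_sum_eq[OF assms] by (simp add: vertex_degree_altdef[OF assms])
qed

lemma has_cycle_of_length_cycle_list:
  assumes "cycle_list (adj E) xs"
  shows "has_cycle_of_length E (length xs)"
proof -
  have xs: "3 \<le> length xs" "distinct xs" "adj E (last xs) (hd xs)"
    and succ: "\<And>i. Suc i < length xs \<Longrightarrow> adj E (xs ! i) (xs ! Suc i)"
    using assms by (auto simp: cycle_list_def successively_conv_nth)
  then have "xs \<noteq> []"
    by auto
  have "{xs ! i, xs ! ((i + 1) mod length xs)} \<in> E" if "i < length xs" for i
  proof (cases "Suc i < length xs")
    case True
    then show ?thesis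
      using succ[OF True] by (simp add: adj_def)
  next
    case False
    with that have "Suc i = length xs"
      by simp
    then have "i = length xs - 1"
      by simp
    then show ?thesis
      using xs(3) \<open>xs \<noteq> []\<close> \<open>Suc i = length xs\<close> by (simp add: adj_def last_conv_nth hd_conv_nth)
  qed
  then show ?thesis
    using xs unfolding has_cycle_of_length_def by blast
qed

lemma has_path_of_length_path:
  assumes "distinct xs" "successively (adj E) xs" "t < length xs"
  shows "has_path_of_length E t"
  unfolding has_path_of_length_def
proof (intro exI conjI allI impI)
  show "length (take (t + 1) xs) = t + 1" "distinct (take (t + 1) xs)"
    using assms by auto
  fix i assume "i < t"
  then show "{take (t + 1) xs ! i, take (t + 1) xs ! (i + 1)} \<in> E"
    using assms by (simp add: successively_conv_nth adj_def)
qed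

lemma card_edges_no_long_cycle:
  fixes F :: "'v::finite set set"
  assumes F: "simple_graph F" "\<And>e. e \<in> F \<Longrightarrow> e \<subseteq> U" and t: "2 \<le> t" "\<And>l. t < l \<Longrightarrow> \<not> has_cycle_of_length F l"
  shows "2 * card F \<le> t * (card U - 1)"
proof (cases "U = {}")
  case True
  then have "F = {}"
    using F by (force simp: simple_graph_def)
  then show ?thesis
    by simp
next
  case False
  have "length xs \<le> t" if "cycle_list (adj F) xs" for xs
    using has_cycle_of_length_cycle_list[OF that] t(2) not_le by blast
  then show ?thesis
    using card_arcs_no_long_cycle[OF graph_on_adj_subset[OF F] False t(1)] card_arcs_adj[OF F(1)] by simp
qed

text \<open>A path becomes a cycle in the graph with one additional vertex that is adjacent to all others.\<close>

definition cone :: "'a set \<Rightarrow> ('a \<Rightarrow> 'a \<Rightarrow> bool) \<Rightarrow> 'a option \<Rightarrow> 'a option \<Rightarrow> bool" where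
  "cone U R x y \<longleftrightarrow> (case (x, y) of (Some u, Some v) \<Rightarrow> R u v | (Some u, None) \<Rightarrow> u \<in> U
     | (None, Some v) \<Rightarrow> v \<in> U | (None, None) \<Rightarrow> False)"

lemma cone_simps [simp]:
  "cone U R (Some u) (Some v) = R u v" "cone U R (Some u) None \<longleftrightarrow> u \<in> U"
  "cone U R None (Some v) \<longleftrightarrow> v \<in> U" "\<not> cone U R None None"
  by (simp_all add: cone_def)

lemma graph_on_cone:
  assumes "graph_on U R"
  shows "graph_on (insert None (Some ` U)) (cone U R)"
  unfolding graph_on_def
proof (intro conjI allI impI)
  show "finite (insert None (Some ` U))"
    using assms by (simp add: graph_on_def)
  fix x y assume "cone U R x y"
  then show "x \<in> insert None (Some ` U)" "y \<in> insert None (Some ` U)" "x \<noteq> y" "cone U R y x"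
    using graph_onD[OF assms] by (cases x; cases y; auto)+
qed

lemma card_arcs_cone:
  assumes R: "graph_on U R"
  shows "card (arcs (cone U R)) = card (arcs R) + 2 * card U"
proof -
  have fin: "finite U" "finite (arcs R)"
    using graph_onD[OF R] finite_arcs[OF R] by auto
  have eq: "arcs (cone U R) = map_prod Some Some ` arcs R \<union> (Some ` U \<times> {None} \<union> {None} \<times> Some ` U)"
  proof (rule set_eqI)
    fix z :: "'a option \<times> 'a option"
    show "z \<in> arcs (cone U R) \<longleftrightarrow> z \<in> map_prod Some Some ` arcs R \<union> (Some ` U \<times> {None} \<union> {None} \<times> Some ` U)"
      by (cases z; cases "fst z"; cases "snd z") (auto simp: arcs_def)
  qed
  have "card (Some ` U \<times> {None} \<union> {None} \<times> Some ` U) = card U + card U"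
    using fin by (subst card_Un_disjoint) (auto simp: card_cartesian_product card_image)
  moreover have "card (map_prod Some Some ` arcs R) = card (arcs R)"
    by (intro card_image inj_onI) auto
  ultimately show ?thesis
    unfolding eq using fin by (subst card_Un_disjoint) auto
qed

lemma cone_path:
  assumes "successively (cone U R) zs" "None \<notin> set zs" "distinct zs"
  shows "successively R (map the zs)" "distinct (map the zs)"
proof -
  show "successively R (map the zs)"
    unfolding successively_map using assms(1)
    by (rule successively_mono) (use assms(2) in \<open>auto simp: cone_def split: option.splits\<close>)
  show "distinct (map the zs)"
    using assms(2,3) by (auto simp: distinct_map inj_on_def) (metis option.collapse)
qed

text \<open>A cycle of the cone with more than \<open>t + 1\<close> vertices leaves a path on more
  than \<open>t\<close> vertices once the apex is removed. So the cycle bound holds with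
  \<open>t + 1\<close>, and the \<open>2 * card U\<close> arcs at the apex lower this factor to
  \<open>t - 1\<close>.\<close>

lemma card_edges_no_long_path:
  fixes F :: "'v::finite set set"
  assumes F: "simple_graph F" "\<And>e. e \<in> F \<Longrightarrow> e \<subseteq> U" and t: "1 \<le> t" "\<not> has_path_of_length F t"
  shows "2 * card F \<le> (t - 1) * card U"
proof -
  note R = graph_on_adj_subset[OF F]
  have fin: "finite U"
    by simp
  have short: "length xs \<le> t + 1" if xs: "cycle_list (cone U (adj F)) xs" for xs
  proof (rule ccontr)
    assume long: "\<not> length xs \<le> t + 1"
    obtain zs where zs: "successively (cone U (adj F)) zs" "None \<notin> set zs" "distinct zs" "t < length zs"
    proof (cases "None \<in> set xs")
      case True
      then obtain ps where ps: "cycle_list (cone U (adj F)) (None # ps)" "length (None # ps) = length xs"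
        using cycle_list_start[OF xs] by metis
      then show thesis
        using that[of ps] long by (auto simp: cycle_list_def successively_Cons)
    next
      case False
      then show thesis
        using that[of xs] xs long by (auto simp: cycle_list_def)
    qed
    then have "has_path_of_length F t"
      using cone_path[OF zs(1-3)] by (intro has_path_of_length_path[of "map the zs"]) auto
    then show False
      using t by simp
  qed
  have "card (insert None (Some ` U)) = card U + 1"
    by (simp add: card_image)
  then have "card (arcs (cone U (adj F))) \<le> (t + 1) * card U"
    using card_arcs_no_long_cycle[OF graph_on_cone[OF R], of "t + 1"] short t by simp
  then have "2 * card F + 2 * card U \<le> (t + 1) * card U"
    by (simp add: card_arcs_cone[OF R] card_arcs_adj[OF F(1)])
  moreover have "(t + 1) * card U = (t - 1) * card U + 2 * card U"
    using t by (cases t) (auto simp: algebra_simps)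
  ultimately show ?thesis
    by simp
qed

lemma planar_card_edges:
  fixes E :: "'v::finite set set"
  assumes E: "simple_graph E" "planar E" and U: "3 \<le> card U"
  shows "card {e\<in>E. e \<subseteq> U} + 6 \<le> 3 * card U"
proof -
  from E(2)[unfolded planar_def] show ?thesis
  proof (elim exE conjE)
    fix p :: "'v \<Rightarrow> complex" and \<gamma> :: "'v set \<Rightarrow> real \<Rightarrow> complex"
    assume p: "inj p"
      and edge: "\<forall>e\<in>E. arc (\<gamma> e) \<and> {pathstart (\<gamma> e), pathfinish (\<gamma> e)} = p ` e
        \<and> path_image (\<gamma> e) \<inter> range p = p ` e"
      and cross: "\<forall>e\<in>E. \<forall>f\<in>E. e \<noteq> f \<longrightarrow> path_image (\<gamma> e) \<inter> path_image (\<gamma> f) \<subseteq> range p"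
    interpret plane_drawing U "{e\<in>E. e \<subseteq> U}" p \<gamma>
    proof
      fix e f assume e: "e \<in> {e\<in>E. e \<subseteq> U}"
      then show "e \<subseteq> U \<and> card e = 2" "arc (\<gamma> e)" "{pathstart (\<gamma> e), pathfinish (\<gamma> e)} = p ` e"
        using edge E by (auto simp: simple_graph_def)
      have "path_image (\<gamma> e) \<inter> range p = p ` e"
        using edge e by simp
      then show on: "path_image (\<gamma> e) \<inter> p ` U = p ` e"
        using e by blast
      assume "f \<in> {e\<in>E. e \<subseteq> U}" "e \<noteq> f"
      then have "path_image (\<gamma> e) \<inter> path_image (\<gamma> f) \<subseteq> range p"
        using cross e by simp
      then show "path_image (\<gamma> e) \<inter> path_image (\<gamma> f) \<subseteq> p ` U"
        using \<open>path_image (\<gamma> e) \<inter> range p = p ` e\<close> e by blast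
    qed (use p in \<open>auto intro: inj_on_subset\<close>)
    show ?thesis
      using card_edges_le U by blast
  qed
qed

text \<open>Counting paths of length two by their pair of end vertices.\<close>

lemma card_edges_square_le:
  fixes F :: "'v::finite set set"
  assumes F: "simple_graph F" "\<And>e. e \<in> F \<Longrightarrow> e \<subseteq> U"
    and unique: "\<And>a b u v. a \<noteq> b \<Longrightarrow> adj F u a \<Longrightarrow> adj F u b \<Longrightarrow> adj F v a \<Longrightarrow> adj F v b \<Longrightarrow> u = v"
    and ends: "\<And>a b u. a \<noteq> b \<Longrightarrow> adj F u a \<Longrightarrow> adj F u b \<Longrightarrow> (a, b) \<in> S"
  shows "(2 * card F)\<^sup>2 \<le> card U * (card S + 2 * card F)"
proof -
  have degU: "vertex_degree F u = 0" if "u \<notin> U" for u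
    using F(2) that by (auto simp: vertex_degree_def)
  define N where "N u = {v. adj F u v}" for u
  define T where "T = Sigma UNIV (\<lambda>u. {(a, b). a \<in> N u \<and> b \<in> N u \<and> a \<noteq> b})"
  have "inj_on snd T"
    using unique by (auto simp: inj_on_def T_def N_def)
  moreover have "snd ` T \<subseteq> S"
    using ends by (auto simp: T_def N_def)
  ultimately have "card T \<le> card S"
    by (intro card_inj_on_le) auto
  have pairs: "card {(a, b). a \<in> N u \<and> b \<in> N u \<and> a \<noteq> b} + card (N u) = (card (N u))\<^sup>2" for u
  proof -
    have "N u \<times> N u = {(a, b). a \<in> N u \<and> b \<in> N u \<and> a \<noteq> b} \<union> (\<lambda>a. (a, a)) ` N u"
      by auto
    moreover have "card ({(a, b). a \<in> N u \<and> b \<in> N u \<and> a \<noteq> b} \<union> (\<lambda>a. (a, a)) ` N u)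
        = card {(a, b). a \<in> N u \<and> b \<in> N u \<and> a \<noteq> b} + card ((\<lambda>a. (a, a)) ` N u)"
      by (intro card_Un_disjoint) auto
    moreover have "card ((\<lambda>a. (a, a)) ` N u) = card (N u)"
      by (intro card_image inj_onI) auto
    moreover have "card (N u \<times> N u) = (card (N u))\<^sup>2"
      by (simp add: card_cartesian_product power2_eq_square)
    ultimately show ?thesis
      by (simp only:)
  qed
  have deg: "vertex_degree F u = card (N u)" for u
    by (simp add: vertex_degree_altdef[OF F(1)] N_def)
  have sumU: "(\<Sum>u\<in>U. f (vertex_degree F u)) = (\<Sum>u\<in>UNIV. f (vertex_degree F u))" if "f 0 = (0::nat)" for f
    using degU that by (intro sum.mono_neutral_left) auto
  have "(\<Sum>u\<in>U. (vertex_degree F u)\<^sup>2) = (\<Sum>u\<in>UNIV. (card (N u))\<^sup>2)"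
    using sumU[of "\<lambda>d. d\<^sup>2"] by (simp add: deg)
  also have "\<dots> = (\<Sum>u\<in>UNIV. card {(a, b). a \<in> N u \<and> b \<in> N u \<and> a \<noteq> b} + card (N u))"
    by (simp add: pairs)
  also have "\<dots> = card T + 2 * card F"
    using degree_sum_eq[OF F(1)] by (simp add: sum.distrib T_def card_SigmaI deg)
  finally have le: "(\<Sum>u\<in>U. (vertex_degree F u)\<^sup>2) \<le> card S + 2 * card F"
    using \<open>card T \<le> card S\<close> by simp
  have "real ((2 * card F)\<^sup>2) = (\<Sum>u\<in>U. 1 * real (vertex_degree F u))\<^sup>2"
    using sumU[of "\<lambda>d. d"] degree_sum_eq[OF F(1)] by (simp flip: of_nat_sum)
  also have "\<dots> \<le> (\<Sum>u\<in>U. 1\<^sup>2) * (\<Sum>u\<in>U. (real (vertex_degree F u))\<^sup>2)"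
    by (rule Cauchy_Schwarz_ineq_sum)
  also have "\<dots> = real (card U * (\<Sum>u\<in>U. (vertex_degree F u)\<^sup>2))"
    by simp
  finally have "(2 * card F)\<^sup>2 \<le> card U * (\<Sum>u\<in>U. (vertex_degree F u)\<^sup>2)"
    by (simp only: of_nat_le_iff)
  also have "\<dots> \<le> card U * (card S + 2 * card F)"
    using le by (rule mult_left_mono) simp
  finally show "(2 * card F)\<^sup>2 \<le> card U * (card S + 2 * card F)" .
qed

lemma square_free_unique:
  assumes "simple_graph E" "square_free E" "a \<noteq> b" "adj E u a" "adj E u b" "adj E v a" "adj E v b"
  shows "u = v"
proof (rule ccontr)
  assume "u \<noteq> v"
  then have "cycle_list (adj E) [u, a, v, b]"
    using assms adj_irrefl[OF assms(1)] by (auto simp: cycle_list_def adj_commute)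
  from has_cycle_of_length_cycle_list[OF this] show False
    using assms(2) by (simp add: square_free_def eval_nat_numeral)
qed

lemma card_off_diagonal: "card {(a, b). a \<in> U \<and> b \<in> U \<and> a \<noteq> b} = card U * (card U - 1)"
  for U :: "'v::finite set"
proof -
  have "{(a, b). a \<in> U \<and> b \<in> U \<and> a \<noteq> b} = Sigma U (\<lambda>a. U - {a})"
    by auto
  then show ?thesis
    by (simp add: card_SigmaI)
qed

lemma square_free_card_edges:
  fixes E :: "'v::finite set set"
  assumes E: "simple_graph E" "square_free E" and U: "card U \<le> 2 * k" "1 \<le> k"
  shows "real (card {e\<in>E. e \<subseteq> U}) \<le> real k * (1 + sqrt (8 * real k - 3)) / 2"
proof -
  define F where "F = {e\<in>E. e \<subseteq> U}"
  have F: "simple_graph F" "\<And>e. e \<in> F \<Longrightarrow> e \<subseteq> U"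
    using E by (auto simp: F_def simple_graph_def)
  have adj: "adj F x y \<Longrightarrow> adj E x y \<and> x \<in> U \<and> y \<in> U" for x y
    by (auto simp: F_def adj_def)
  define m where "m = real (2 * card F)"
  define n where "n = real (2 * k)"
  have "(2 * card F)\<^sup>2 \<le> card U * (card {(a, b). a \<in> U \<and> b \<in> U \<and> a \<noteq> b} + 2 * card F)"
    by (rule card_edges_square_le[OF F]) (use square_free_unique[OF E] adj in blast)+
  also have "\<dots> \<le> (2 * k) * ((2 * k) * (2 * k - 1) + 2 * card F)"
    unfolding card_off_diagonal using U by (intro mult_mono add_mono) auto
  finally have "real ((2 * card F)\<^sup>2) \<le> real ((2 * k) * ((2 * k) * (2 * k - 1) + 2 * card F))"
    by (simp only: of_nat_le_iff)
  then have "m\<^sup>2 \<le> n * (n * (n - 1) + m)"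
    using U by (simp add: m_def n_def of_nat_diff)
  \<comment> \<open>The preceding quadratic inequality in \<open>m\<close>, multiplied by 4 and
    completed to a square; \<open>4 * n - 3\<close> with \<open>n = 2 * k\<close> is the radicand
    \<open>8 * k - 3\<close>.\<close>
  then have "(2 * m - n)\<^sup>2 \<le> n\<^sup>2 * (4 * n - 3)"
    by (simp add: power2_eq_square algebra_simps)
  then have "2 * m - n \<le> sqrt (n\<^sup>2 * (4 * n - 3))"
    by (rule real_le_rsqrt)
  also have "\<dots> = n * sqrt (4 * n - 3)"
    by (simp add: real_sqrt_mult n_def)
  finally show ?thesis
    by (simp add: m_def n_def F_def algebra_simps)
qed

text \<open>Without triangles the ends of a path of length two are not adjacent, so the admissible
  end pairs \<open>S\<close> omit the \<open>2 * card F\<close> adjacent ones. This cancels the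
  linear term of the quadratic inequality and leaves a plain square root.\<close>

lemma girth_five_card_edges:
  fixes E :: "'v::finite set set"
  assumes E: "simple_graph E" "girth_at_least 5 E" and U: "card U \<le> 2 * k" "1 \<le> k"
  shows "real (card {e\<in>E. e \<subseteq> U}) \<le> real k * sqrt (2 * real k - 1)"
proof -
  define F where "F = {e\<in>E. e \<subseteq> U}"
  have F: "simple_graph F" "\<And>e. e \<in> F \<Longrightarrow> e \<subseteq> U"
    using E by (auto simp: F_def simple_graph_def)
  have adj: "adj F x y \<Longrightarrow> adj E x y \<and> x \<in> U \<and> y \<in> U" for x y
    by (auto simp: F_def adj_def)
  have sf: "square_free E"
    using E(2) by (auto simp: girth_at_least_def square_free_def)
  have triangle: "\<not> adj E a b" if "adj E u a" "adj E u b" for a b u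
  proof
    assume "adj E a b"
    then have "cycle_list (adj E) [u, a, b]"
      using that adj_irrefl[OF E(1)] by (auto simp: cycle_list_def adj_commute)
    from has_cycle_of_length_cycle_list[OF this] show False
      using E(2) by (simp add: girth_at_least_def)
  qed
  define S where "S = {(a, b). a \<in> U \<and> b \<in> U \<and> a \<noteq> b} - arcs (adj F)"
  have sub: "arcs (adj F) \<subseteq> {(a, b). a \<in> U \<and> b \<in> U \<and> a \<noteq> b}"
    using adj adj_irrefl[OF F(1)] by (auto simp: arcs_def)
  have "card S = card U * (card U - 1) - 2 * card F"
    unfolding S_def using sub by (simp add: card_Diff_subset card_off_diagonal card_arcs_adj[OF F(1)])
  moreover have "2 * card F \<le> card U * (card U - 1)"
    using card_mono[OF _ sub] by (simp add: card_off_diagonal card_arcs_adj[OF F(1)])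
  ultimately have cS: "card S + 2 * card F = card U * (card U - 1)"
    by simp
  have "(2 * card F)\<^sup>2 \<le> card U * (card S + 2 * card F)"
  proof (rule card_edges_square_le[OF F])
    show "u = v" if "a \<noteq> b" "adj F u a" "adj F u b" "adj F v a" "adj F v b" for a b u v
      using square_free_unique[OF E(1) sf that(1)] adj that by blast
    show "(a, b) \<in> S" if "a \<noteq> b" "adj F u a" "adj F u b" for a b u
      using that adj[of u a] adj[of u b] adj[of a b] triangle[of u a b] by (auto simp: S_def arcs_def)
  qed
  also have "\<dots> \<le> (2 * k) * ((2 * k) * (2 * k - 1))"
    unfolding cS using U by (intro mult_mono) auto
  finally have "real ((2 * card F)\<^sup>2) \<le> real ((2 * k) * ((2 * k) * (2 * k - 1)))"
    by (simp only: of_nat_le_iff)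
  then have "(real (card F))\<^sup>2 \<le> (real k)\<^sup>2 * (2 * real k - 1)"
    using U by (simp add: of_nat_diff power2_eq_square algebra_simps)
  then have "real (card F) \<le> sqrt ((real k)\<^sup>2 * (2 * real k - 1))"
    by (rule real_le_rsqrt)
  then show ?thesis
    by (simp add: real_sqrt_mult F_def)
qed

section \<open>From which k on the bounds imply the one conjectured by Brouwer\<close>

section \<open>Comparison with the binomial coefficient\<close>

lemma real_choose_two: "real ((k + 1) choose 2) = real k * (real k + 1) / 2"
proof -
  have "2 * ((k + 1) choose 2) = (k + 1) * k"
    by (simp add: choose_two)
  then have "2 * real ((k + 1) choose 2) = (real k + 1) * real k"
    by (metis of_nat_1 of_nat_add of_nat_mult of_nat_numeral)
  then show ?thesis
    by (simp add: mult.commute)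
qed

lemma of_nat_le_of_int_floor: "real n \<le> x \<Longrightarrow> real n \<le> of_int \<lfloor>x\<rfloor>"
  by (metis le_floor_iff of_int_le_iff of_int_of_nat_eq)

lemma planar_bound_le_choose:
  assumes "10 \<le> k"
  shows "6 * real k - 6 \<le> real ((k + 1) choose 2)"
proof -
  \<comment> \<open>The binomial coefficient exceeds \<open>6 * k - 6\<close> by half of this
    product plus 1.\<close>
  have "0 \<le> (real k - 10) * (real k - 1)"
    using assms by (intro mult_nonneg_nonneg) auto
  then show ?thesis
    unfolding real_choose_two by (simp add: algebra_simps)
qed

text \<open>From \<open>k = 8\<close> on, \<open>8 * k - 3 \<le> k\<^sup>2\<close> suffices. At
  \<open>k = 7\<close> the real bound lies slightly above the binomial coefficient 28 and only
  integrality of \<open>n\<close> helps; \<open>51 / 7\<close> is the value at which the bound would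
  reach 29.\<close>

lemma square_free_bound_le_choose:
  assumes n: "real n \<le> real k * (1 + sqrt (8 * real k - 3)) / 2" and k: "7 \<le> k"
  shows "real n \<le> real ((k + 1) choose 2)"
proof (cases "k = 7")
  case True
  have "sqrt 53 < 51 / 7"
    by (rule real_less_lsqrt) (auto simp: power2_eq_square)
  then have "real n < 29"
    using n True by simp
  then show ?thesis
    unfolding real_choose_two True by simp
next
  case False
  then have "8 \<le> real k"
    using k by linarith
  then have "0 \<le> real k * (real k - 8)"
    by (intro mult_nonneg_nonneg) auto
  then have "sqrt (8 * real k - 3) \<le> real k"
    by (intro real_le_lsqrt) (auto simp: power2_eq_square algebra_simps)
  then have "real k * (1 + sqrt (8 * real k - 3)) \<le> real k * (1 + real k)"
    by (intro mult_left_mono) auto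
  then show ?thesis
    unfolding real_choose_two using n by (simp add: algebra_simps)
qed

text \<open>Comparing squares gives the condition \<open>(k - 1) * (k - 5) \<ge> 0\<close>, which
  fails exactly for \<open>k = 2, 3, 4\<close>. In these cases the real bound exceeds the binomial
  coefficient by less than 1, and \<open>n\<close> is an integer; 2, \<open>7 / 3\<close> and
  \<open>11 / 4\<close> are the roots at which it would reach 4, 7 and 11.\<close>

lemma girth_bound_le_choose:
  assumes n: "real n \<le> real k * sqrt (2 * real k - 1)" and k: "1 \<le> k"
  shows "real n \<le> real ((k + 1) choose 2)"
proof -
  consider "k = 2" | "k = 3" | "k = 4" | "k = 1 \<or> 5 \<le> k"
    using k by linarith
  then show ?thesis
  proof cases
    case 1
    have "sqrt 3 < 2"
      by (rule real_less_lsqrt) auto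
    then have "real n < 4"
      using n 1 by simp
    then show ?thesis
      unfolding real_choose_two 1 by simp
  next
    case 2
    have "sqrt 5 < 7 / 3"
      by (rule real_less_lsqrt) (auto simp: power2_eq_square)
    then have "real n < 7"
      using n 2 by simp
    then show ?thesis
      unfolding real_choose_two 2 by simp
  next
    case 3
    have "sqrt 7 < 11 / 4"
      by (rule real_less_lsqrt) (auto simp: power2_eq_square)
    then have "real n < 11"
      using n 3 by simp
    then show ?thesis
      unfolding real_choose_two 3 by simp
  next
    case 4
    then have "0 \<le> (real k - 1) * (real k - 5)"
      by auto
    then have "sqrt (2 * real k - 1) \<le> (real k + 1) / 2"
      by (intro real_le_lsqrt) (auto simp: power2_eq_square algebra_simps)
    then have "real k * sqrt (2 * real k - 1) \<le> real k * ((real k + 1) / 2)"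
      by (intro mult_left_mono) auto
    then show ?thesis
      unfolding real_choose_two using n by simp
  qed
qed

theorem proposition5p3:
  fixes E :: "'v::finite set set" and k :: nat
  assumes "simple_graph E" and "k \<ge> 1" and "CARD('v) \<ge> k"
  defines "S \<equiv> (\<Sum>i = 1..k. eigval (laplacian E) i)"
  shows
    "(forest E \<longrightarrow> S \<le> real (card E) + 2 * real k - 1) \<and>
     (\<forall>\<Delta>::nat. max_degree E \<le> \<Delta> \<longrightarrow> S \<le> real (card E) + real k * real (min \<Delta> k)) \<and>
     (planar E \<longrightarrow>
        (k \<ge> 2 \<longrightarrow> S \<le> real (card E) + 6 * real k - 6) \<and>
        (k \<ge> 10 \<longrightarrow> S \<le> real (card E) + real ((k + 1) choose 2))) \<and>
     (square_free E \<longrightarrow>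
        S \<le> real (card E) + of_int \<lfloor>real k * (1 + sqrt (8 * real k - 3)) / 2\<rfloor> \<and>
        (k \<ge> 7 \<longrightarrow> S \<le> real (card E) + real ((k + 1) choose 2))) \<and>
     (girth_at_least 5 E \<longrightarrow>
        S \<le> real (card E) + of_int \<lfloor>real k * sqrt (2 * real k - 1)\<rfloor> \<and>
        S \<le> real (card E) + real ((k + 1) choose 2)) \<and>
     (\<forall>t::nat. t \<ge> 1 \<longrightarrow> \<not> has_path_of_length E t \<longrightarrow>
        S \<le> real (card E) + real k * (real t - 1)) \<and>
     (\<forall>t::nat. t \<ge> 2 \<longrightarrow> \<not> (\<exists>l>t. has_cycle_of_length E l) \<longrightarrow>
        S \<le> real (card E) + of_int \<lfloor>real t * (2 * real k - 1) / 2\<rfloor>)"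
proof -
  note E = assms(1) and k = assms(2)
  obtain P where "orthogonal_projection P k" and S: "S = orthogonal_projection.laplacian_trace P E"
    using eigval_laplacian_sum[OF E assms(3)] unfolding S_def by blast
  then interpret orthogonal_projection P k
    by simp
  obtain U where U: "card U \<le> 2 * k" and trace_le: "laplacian_trace E \<le> card E + card {e\<in>E. e \<subseteq> U}"
    using laplacian_trace_le_induced[OF E] by blast
  define F where "F = {e\<in>E. e \<subseteq> U}"
  have F: "simple_graph F" "\<And>e. e \<in> F \<Longrightarrow> e \<subseteq> U"
    using E by (auto simp: F_def simple_graph_def)
  have cycleF: "has_cycle_of_length F l \<Longrightarrow> has_cycle_of_length E l"
    and pathF: "has_path_of_length F l \<Longrightarrow> has_path_of_length E l" for l
    by (auto simp: F_def has_cycle_of_length_def has_path_of_length_def)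
  have SF: "S \<le> real (card E) + real (card F)"
    using trace_le by (simp add: S F_def)
  have cycle_bound: "2 * real (card F) \<le> real t * (2 * real k - 1)"
    if t: "2 \<le> t" "\<not> (\<exists>l>t. has_cycle_of_length E l)" for t
  proof -
    have "2 * card F \<le> t * (card U - 1)"
      using t cycleF by (intro card_edges_no_long_cycle[OF F]) auto
    also have "\<dots> \<le> t * (2 * k - 1)"
      using U by (intro mult_left_mono) auto
    finally have "real (2 * card F) \<le> real (t * (2 * k - 1))"
      by (simp only: of_nat_le_iff)
    then show ?thesis
      using k by (simp add: of_nat_diff)
  qed
  show ?thesis
  proof (intro conjI allI impI)
    assume "forest E"
    \<comment> \<open>A forest is the case \<open>t = 2\<close> of the cycle bound, as cycles have
      length at least 3.\<close>
    then have "2 * real (card F) \<le> 2 * (2 * real k - 1)"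
      using cycle_bound[of 2] by (auto simp: forest_def)
    then show "S \<le> real (card E) + 2 * real k - 1"
      using SF by simp
  next
    fix \<Delta> assume \<Delta>: "max_degree E \<le> \<Delta>"
    have "vertex_degree E u \<le> \<Delta>" for u
      using Max_ge[of "range (vertex_degree E)" "vertex_degree E u"] \<Delta> by (auto simp: max_degree_def)
    then show "S \<le> real (card E) + real k * real (min \<Delta> k)"
      using laplacian_trace_le_max_degree[OF E] laplacian_trace_le_square[OF E k] S
      by (simp add: min_def)
  next
    assume planar: "planar E"
    \<comment> \<open>Below three vertices only the bound by one edge is left, and
      \<open>6 * k - 6\<close> covers it from \<open>k = 2\<close> on. For \<open>k = 1\<close> the
      claim would fail: a single edge has largest eigenvalue 2.\<close>
    have *: "real (card F) \<le> 6 * real k - 6" if "2 \<le> k"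
    proof (cases "3 \<le> card U")
      case True
      then have "card F + 6 \<le> 3 * card U"
        unfolding F_def by (rule planar_card_edges[OF E planar])
      then show ?thesis
        using U by linarith
    next
      case False
      then have "card F \<le> 1"
        using card_induced_le_1[OF E, of U] by (simp add: F_def)
      then show ?thesis
        using that by linarith
    qed
    show "S \<le> real (card E) + 6 * real k - 6" if "2 \<le> k"
      using SF *[OF that] by simp
    show "S \<le> real (card E) + real ((k + 1) choose 2)" if "10 \<le> k"
      using SF * planar_bound_le_choose[OF that] that by simp
  next
    assume "square_free E"
    from square_free_card_edges[OF E this U k]
    have *: "real (card F) \<le> real k * (1 + sqrt (8 * real k - 3)) / 2"
      by (simp add: F_def)
    show "S \<le> real (card E) + of_int \<lfloor>real k * (1 + sqrt (8 * real k - 3)) / 2\<rfloor>"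
      using SF of_nat_le_of_int_floor[OF *] by linarith
    show "S \<le> real (card E) + real ((k + 1) choose 2)" if "7 \<le> k"
      using SF square_free_bound_le_choose[OF * that] by linarith
  next
    assume "girth_at_least 5 E"
    from girth_five_card_edges[OF E this U k]
    have *: "real (card F) \<le> real k * sqrt (2 * real k - 1)"
      by (simp add: F_def)
    show "S \<le> real (card E) + of_int \<lfloor>real k * sqrt (2 * real k - 1)\<rfloor>"
      using SF of_nat_le_of_int_floor[OF *] by linarith
    show "S \<le> real (card E) + real ((k + 1) choose 2)"
      using SF girth_bound_le_choose[OF * k] by linarith
  next
    fix t :: nat assume t: "1 \<le> t" "\<not> has_path_of_length E t"
    have "2 * card F \<le> (t - 1) * card U"
      using t pathF by (intro card_edges_no_long_path[OF F]) auto
    also have "\<dots> \<le> (t - 1) * (2 * k)"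
      using U by (rule mult_left_mono) simp
    finally have "real (2 * card F) \<le> real ((t - 1) * (2 * k))"
      by (simp only: of_nat_le_iff)
    then have "real (card F) \<le> real k * (real t - 1)"
      using t by (simp add: of_nat_diff mult.commute)
    then show "S \<le> real (card E) + real k * (real t - 1)"
      using SF by simp
  next
    fix t :: nat assume "2 \<le> t" "\<not> (\<exists>l>t. has_cycle_of_length E l)"
    then have "real (card F) \<le> real t * (2 * real k - 1) / 2"
      using cycle_bound[of t] by simp
    from of_nat_le_of_int_floor[OF this]
    show "S \<le> real (card E) + of_int \<lfloor>real t * (2 * real k - 1) / 2\<rfloor>"
      using SF by linarith
  qed
qed

end
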